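(* Let $q\in\mathbb{N}\setminus\{1\}$ and let $X$ be the geometric armadillo tail with parameter $r=\frac{1}{q}$. Then there exists a cylinder in the direction of slope $\frac{1}{2-r}=\frac{q}{2q-1}$ which lies entirely in $\square_1\cup\square_2$.
   Context: Set $l_k=r^{k-1}$, $s_k=l_1+\dots+l_k$ ($s_0=0$), and $\square_k=[s_{k-1},s_k]\times[0,l_k]\subset\mathbb{R}^2$. The geometric armadillo tail with parameter $r$ is obtained from $P=\bigcup_k\square_k$ by gluing the top edge of each $\square_k$ to its bottom edge by vertical translation, and for each $k\ge1$ gluing $\{s_k\}\times[l_{k+1},l_k]$ by horizontal translation to $\{0\}\times[l_{k+1},l_k]$; then taking the metric completion, in which all vertices become a single wild singularity. Slopes are measured in the polygonal representation. A saddle connection is a closed straight-line segment from the singularity to itself with no singular point in its interior. A cylinder is a closed subset whose interior is foliated by homotopic closed straight-line trajectories and whose boundary consists of saddle connections. *)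

theory Defs
  imports "HOL-Analysis.Analysis"
begin

text \<open>Geometric armadillo tail with parameter r, in its polygonal representation.
  Points of the surface X are equivalence classes of points of the polygon P;
  all vertices of P form one class, the singularity.\<close>

definition arm_l :: "real \<Rightarrow> nat \<Rightarrow> real" where
  "arm_l r k = r ^ (k - 1)"

definition arm_s :: "real \<Rightarrow> nat \<Rightarrow> real" where
  "arm_s r k = (\<Sum>i\<in>{1..k}. arm_l r i)"

text \<open>The square number k (k >= 1).\<close>
definition arm_square :: "real \<Rightarrow> nat \<Rightarrow> (real \<times> real) set" where
  "arm_square r k = {arm_s r (k - 1) .. arm_s r k} \<times> {0 .. arm_l r k}"

definition arm_P :: "real \<Rightarrow> (real \<times> real) set" where
  "arm_P r = (\<Union>k\<in>{1..}. arm_square r k)"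

text \<open>Vertices of the polygon P (they all become the single singularity).\<close>
definition arm_V :: "real \<Rightarrow> (real \<times> real) set" where
  "arm_V r = {(arm_s r k, 0) | k. True} \<union> {(arm_s r k, arm_l r k) | k. k \<ge> 1}
           \<union> {(arm_s r k, arm_l r (k + 1)) | k. True} \<union> {(0, arm_l r k) | k. k \<ge> 1}"

text \<open>Edge gluings: top edge of square k to its bottom edge (vertical translation),
  and the segment {s_k} x [l_(k+1), l_k] to {0} x [l_(k+1), l_k] (horizontal translation).\<close>
definition arm_glue :: "real \<Rightarrow> ((real \<times> real) \<times> (real \<times> real)) set" where
  "arm_glue r =
     {((x, arm_l r k), (x, 0)) | x k. k \<ge> 1 \<and> arm_s r (k - 1) \<le> x \<and> x \<le> arm_s r k}
   \<union> {((arm_s r k, y), (0, y)) | y k. k \<ge> 1 \<and> arm_l r (k + 1) \<le> y \<and> y \<le> arm_l r k}"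

text \<open>The identification relation on P: generated by the gluings, with all vertices
  identified to one point.\<close>
definition arm_rel :: "real \<Rightarrow> ((real \<times> real) \<times> (real \<times> real)) set" where
  "arm_rel r = {(p, q). p \<in> arm_P r \<and> q \<in> arm_P r \<and>
      ((p \<in> arm_V r \<and> q \<in> arm_V r) \<or> (p, q) \<in> (arm_glue r \<union> (arm_glue r)\<inverse>)\<^sup>*)}"

text \<open>Projection of a point of P to the surface.\<close>
definition arm_cls :: "real \<Rightarrow> real \<times> real \<Rightarrow> (real \<times> real) set" where
  "arm_cls r p = arm_rel r `` {p}"

text \<open>The surface X (as a set of classes), its singular point, and its regular part.\<close>
definition arm_X :: "real \<Rightarrow> (real \<times> real) set set" where
  "arm_X r = arm_P r // arm_rel r"

definition arm_sing :: "real \<Rightarrow> (real \<times> real) set" where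
  "arm_sing r = arm_V r"

definition arm_Xreg :: "real \<Rightarrow> (real \<times> real) set set" where
  "arm_Xreg r = arm_X r - {arm_sing r}"

text \<open>Quotient topology on X induced from the Euclidean topology of P.\<close>
definition arm_top :: "real \<Rightarrow> (real \<times> real) set topology" where
  "arm_top r = topology (\<lambda>U. U \<subseteq> arm_X r \<and> openin (top_of_set (arm_P r)) (\<Union>U))"

text \<open>A straight-line path on X with constant velocity w (in the polygonal
  representation), parametrised by [0,1]: near every parameter value it lifts, on each
  side, to a straight segment in P with velocity w.\<close>
definition arm_straight :: "real \<Rightarrow> real \<times> real \<Rightarrow> (real \<Rightarrow> (real \<times> real) set) \<Rightarrow> bool" where
  "arm_straight r w \<gamma> \<longleftrightarrow>
     (\<forall>t\<in>{0..1}.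
        (t < 1 \<longrightarrow> (\<exists>p\<in>arm_P r. arm_cls r p = \<gamma> t \<and> (\<exists>e>0. \<forall>s. t \<le> s \<and> s < t + e \<and> s \<le> 1 \<longrightarrow>
              p + (s - t) *\<^sub>R w \<in> arm_P r \<and> \<gamma> s = arm_cls r (p + (s - t) *\<^sub>R w)))) \<and>
        (0 < t \<longrightarrow> (\<exists>p\<in>arm_P r. arm_cls r p = \<gamma> t \<and> (\<exists>e>0. \<forall>s. t - e < s \<and> s \<le> t \<and> 0 \<le> s \<longrightarrow>
              p - (t - s) *\<^sub>R w \<in> arm_P r \<and> \<gamma> s = arm_cls r (p - (t - s) *\<^sub>R w)))))"

text \<open>Direction vector w has slope m.\<close>
definition has_slope :: "real \<Rightarrow> real \<times> real \<Rightarrow> bool" where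
  "has_slope m w \<longleftrightarrow> fst w \<noteq> 0 \<and> snd w = m * fst w"

text \<open>Closed straight-line trajectory of slope m (avoiding the singularity).\<close>
definition arm_closed_traj :: "real \<Rightarrow> real \<Rightarrow> (real \<Rightarrow> (real \<times> real) set) \<Rightarrow> bool" where
  "arm_closed_traj r m \<gamma> \<longleftrightarrow>
     (\<exists>w. has_slope m w \<and> arm_straight r w \<gamma>) \<and> \<gamma> 0 = \<gamma> 1 \<and> \<gamma> ` {0..1} \<subseteq> arm_Xreg r"

text \<open>Saddle connection: straight segment from the singularity to itself with no
  singular point in its interior.\<close>
definition arm_saddle_conn :: "real \<Rightarrow> (real \<Rightarrow> (real \<times> real) set) \<Rightarrow> bool" where
  "arm_saddle_conn r \<gamma> \<longleftrightarrow>
     (\<exists>w. w \<noteq> 0 \<and> arm_straight r w \<gamma>) \<and> \<gamma> 0 = arm_sing r \<and> \<gamma> 1 = arm_sing r \<and>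
     \<gamma> ` {0<..<1} \<subseteq> arm_Xreg r"

text \<open>Free homotopy of closed curves in the regular part of X.\<close>
definition arm_homotopic_loops :: "real \<Rightarrow> (real \<Rightarrow> (real \<times> real) set) \<Rightarrow> (real \<Rightarrow> (real \<times> real) set) \<Rightarrow> bool" where
  "arm_homotopic_loops r \<gamma> \<delta> \<longleftrightarrow>
     homotopic_with (\<lambda>h. h 0 = h 1) (top_of_set {0..1}) (subtopology (arm_top r) (arm_Xreg r)) \<gamma> \<delta>"

text \<open>Cylinder in the direction of slope m: a closed subset of X whose interior is
  foliated by pairwise homotopic closed straight-line trajectories of slope m and whose
  boundary is a union of saddle connections.\<close>
definition arm_cylinder :: "real \<Rightarrow> real \<Rightarrow> (real \<times> real) set set \<Rightarrow> bool" where
  "arm_cylinder r m C \<longleftrightarrow>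
     C \<subseteq> arm_X r \<and> closedin (arm_top r) C \<and>
     (\<exists>F. F \<noteq> {} \<and> (\<forall>\<gamma>\<in>F. arm_closed_traj r m \<gamma>) \<and>
          (\<Union>\<gamma>\<in>F. \<gamma> ` {0..1}) = (arm_top r) interior_of C \<and>
          (\<forall>\<gamma>\<in>F. \<forall>\<delta>\<in>F. \<gamma> ` {0..1} = \<delta> ` {0..1} \<or> \<gamma> ` {0..1} \<inter> \<delta> ` {0..1} = {}) \<and>
          (\<forall>\<gamma>\<in>F. \<forall>\<delta>\<in>F. arm_homotopic_loops r \<gamma> \<delta>)) \<and>
     (\<exists>S. (\<forall>\<gamma>\<in>S. arm_saddle_conn r \<gamma>) \<and> (\<Union>\<gamma>\<in>S. \<gamma> ` {0..1}) = (arm_top r) frontier_of C)"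

end

theory Submission
  imports Defs
begin

text \<open>Put N = 2 q - 1.  On the torus obtained from the unit square, all lines of slope
  q / N are closed and cross the left edge at N heights spaced by 1 / N.  The slit of length
  r = 1 / q on the right edge, which leads into the second square, is met once or twice by such
  a line.  A line that meets it twice, at heights h and h + 1 / N, crosses the second square
  from height h to height h + 1 / N and returns to the left edge of the unit square there;
  it therefore closes up after 2 q - 3 crossings of the unit square and one of the second
  square.  These lines, 0 < h < r - 1 / N, form the cylinder.  For h = 0 and h = r - 1 / N one
  obtains saddle connections.\<close>

subsection \<open>The quotient surface\<close>

text \<open>On the torus two successive crossings raise the height by 2q/N = 1 + 1/N, that is by 1/N
  modulo 1, and the second square, of width r, raises it by r q/N = 1/N as well. The detour thus
  replaces exactly two of the N crossings, which leaves 2q - 3. Since N r = 2 - r, the condition h +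
  1/N < r reads N h < 1 - r; this is the range of the parameter c = N h used below. The side gluings
  of the first two squares and the top gluing of the unit square change \<open>lev\<close> by
  integers, so c survives them. The top gluing of the second square changes it by 2 - r, so
  invariance of a leaf rests on its never meeting the interior of that edge. The cylinder is
  described twice: by levels (\<open>leaf\<close>), where open and closed sets are visible, and by
  an orbit (\<open>flow\<close>), which yields the trajectories; arithmetic modulo N matches the
  two. The singular class consists of all vertices of P, so closedness of the cylinder involves
  every vertex, also those far from the first two squares.\<close>

locale armadillo =
  fixes r :: real
  assumes r_pos: "0 < r" and r_less_1: "r < 1"
begin

lemma arm_l_pos: "0 < arm_l r k"
  using r_pos by (simp add: arm_l_def)

lemma arm_l_antimono: "i \<le> j \<Longrightarrow> arm_l r j \<le> arm_l r i"
  using r_pos r_less_1 by (auto simp: arm_l_def intro!: power_decreasing)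

lemma arm_l_strict: "1 \<le> i \<Longrightarrow> i < j \<Longrightarrow> arm_l r j < arm_l r i"
  using r_pos r_less_1 by (auto simp: arm_l_def intro!: power_strict_decreasing)

lemma arm_s_Suc: "arm_s r (Suc k) = arm_s r k + r ^ k"
  by (simp add: arm_s_def arm_l_def)

lemma arm_s_0 [simp]: "arm_s r 0 = 0"
  by (simp add: arm_s_def)

lemma arm_s_strict_mono: "strict_mono (arm_s r)"
  using r_pos by (simp add: strict_mono_Suc_iff arm_s_Suc)

lemma arm_s_le_iff: "arm_s r i \<le> arm_s r j \<longleftrightarrow> i \<le> j"
  using arm_s_strict_mono by (rule strict_mono_less_eq)

lemma arm_s_between:
  assumes "arm_s r (k - 1) \<le> arm_s r i" "arm_s r i \<le> arm_s r k"
  shows "i = k - 1 \<or> i = k"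
  using assms by (auto simp: arm_s_le_iff)

lemma arm_l_between:
  assumes "1 \<le> k" "1 \<le> i" "arm_l r (k + 1) \<le> arm_l r i" "arm_l r i \<le> arm_l r k"
  shows "i = k \<or> i = k + 1"
proof -
  have "\<not> i < k" using arm_l_strict[of i k] assms by auto
  moreover have "\<not> k + 1 < i" using arm_l_strict[of "k + 1" i] assms by auto
  ultimately show ?thesis by auto
qed

lemma arm_V_D:
  assumes "(x, y) \<in> arm_V r"
  shows "\<exists>i. x = arm_s r i" and "y = 0 \<or> (\<exists>i\<ge>1. y = arm_l r i)"
proof -
  have "0 = arm_s r 0" by simp
  then show "\<exists>i. x = arm_s r i" using assms unfolding arm_V_def by blast
  have "1 \<le> k + 1" for k :: nat by simp
  then show "y = 0 \<or> (\<exists>i\<ge>1. y = arm_l r i)" using assms unfolding arm_V_def by blast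
qed

lemma arm_P_I: "1 \<le> k \<Longrightarrow> arm_s r (k - 1) \<le> x \<Longrightarrow> x \<le> arm_s r k \<Longrightarrow> 0 \<le> y \<Longrightarrow> y \<le> arm_l r k
    \<Longrightarrow> (x, y) \<in> arm_P r"
  unfolding arm_P_def arm_square_def by auto

lemma arm_P_left: "0 \<le> y \<Longrightarrow> y \<le> 1 \<Longrightarrow> (0, y) \<in> arm_P r"
  using r_pos by (intro arm_P_I[of 1]) (auto simp: arm_s_def arm_l_def)

lemma arm_s_pred_le: "arm_s r (k - 1) \<le> arm_s r k"
  by (simp add: arm_s_le_iff)

lemma arm_l_le_1: "arm_l r k \<le> 1"
  using r_pos r_less_1 by (simp add: arm_l_def power_le_one)

lemma arm_V_subset_P: "arm_V r \<subseteq> arm_P r"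
proof -
  have "(arm_s r k, 0) \<in> arm_P r" for k
    by (cases k) (use arm_P_left[of 0] arm_s_pred_le[of k] arm_l_pos[of k]
        in \<open>auto intro: arm_P_I[of k] less_imp_le\<close>)
  moreover have "(arm_s r k, arm_l r k) \<in> arm_P r" if "1 \<le> k" for k
    using that arm_s_pred_le[of k] arm_l_pos[of k] by (auto intro: arm_P_I[of k] less_imp_le)
  moreover have "(arm_s r k, arm_l r (k + 1)) \<in> arm_P r" for k
    using arm_s_pred_le[of "k + 1"] arm_l_pos[of "k + 1"] by (auto intro: arm_P_I[of "k + 1"] less_imp_le)
  moreover have "(0, arm_l r k) \<in> arm_P r" for k
    using arm_l_pos[of k] arm_l_le_1[of k] by (auto intro: arm_P_left less_imp_le)
  ultimately show ?thesis unfolding arm_V_def by auto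
qed

lemma arm_glue_subset_P:
  assumes "(p, p') \<in> arm_glue r"
  shows "p \<in> arm_P r" "p' \<in> arm_P r"
proof -
  have "p \<in> arm_P r \<and> p' \<in> arm_P r"
    using assms unfolding arm_glue_def
  proof
    assume "(p, p') \<in> {((x, arm_l r k), (x, 0)) |x k.
      1 \<le> k \<and> arm_s r (k - 1) \<le> x \<and> x \<le> arm_s r k}"
    then obtain x k where *: "p = (x, arm_l r k)" "p' = (x, 0)" "1 \<le> k" "arm_s r (k - 1) \<le> x" "x \<le> arm_s r k"
      by auto
    then show ?thesis using arm_l_pos[of k] arm_P_I[of k x] by auto
  next
    assume "(p, p') \<in> {((arm_s r k, y), (0, y)) |y k.
      1 \<le> k \<and> arm_l r (k + 1) \<le> y \<and> y \<le> arm_l r k}"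
    then obtain y k where *: "p = (arm_s r k, y)" "p' = (0, y)" "1 \<le> k" "arm_l r (k + 1) \<le> y" "y \<le> arm_l r k"
      by auto
    have "0 \<le> y" "y \<le> 1" using * arm_l_pos[of "k + 1"] arm_l_le_1[of k] by auto
    then show ?thesis using * arm_s_pred_le[of k] by (auto intro: arm_P_I[of k] arm_P_left)
  qed
  then show "p \<in> arm_P r" "p' \<in> arm_P r" by auto
qed

text \<open>A vertex abscissa on a horizontal edge, or a vertex ordinate on a glued vertical one,
  must belong to an end of that edge by monotonicity of \<open>arm_s\<close> and
  \<open>arm_l\<close>, and the partner is then a vertex too. This keeps the collapsed vertex class
  apart from the gluing classes, as transitivity of \<open>arm_rel\<close> requires.\<close>

lemma arm_glue_V_iff:
  assumes "(p, p') \<in> arm_glue r"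
  shows "p \<in> arm_V r \<longleftrightarrow> p' \<in> arm_V r"
  using assms unfolding arm_glue_def
proof
  assume "(p, p') \<in> {((x, arm_l r k), (x, 0)) |x k.
      1 \<le> k \<and> arm_s r (k - 1) \<le> x \<and> x \<le> arm_s r k}"
  then obtain x k where *: "p = (x, arm_l r k)" "p' = (x, 0)" "1 \<le> k" "arm_s r (k - 1) \<le> x" "x \<le> arm_s r k"
    by auto
  have vs: "p \<in> arm_V r" "p' \<in> arm_V r" if "x = arm_s r i" for i
  proof -
    have "i = k - 1 \<or> i = k" using arm_s_between[of k i] * that by simp
    then show "p \<in> arm_V r"
    proof
      assume "i = k - 1"
      then have "p = (arm_s r i, arm_l r (i + 1))" using * that by simp
      then show ?thesis unfolding arm_V_def by blast
    next
      assume "i = k"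
      then show ?thesis using * that unfolding arm_V_def by blast
    qed
    show "p' \<in> arm_V r" using * that unfolding arm_V_def by blast
  qed
  then show ?thesis using arm_V_D(1) * by metis
next
  assume "(p, p') \<in> {((arm_s r k, y), (0, y)) |y k.
      1 \<le> k \<and> arm_l r (k + 1) \<le> y \<and> y \<le> arm_l r k}"
  then obtain y k where *: "p = (arm_s r k, y)" "p' = (0, y)" "1 \<le> k" "arm_l r (k + 1) \<le> y" "y \<le> arm_l r k"
    by auto
  have y0: "y \<noteq> 0" using * arm_l_pos[of "k + 1"] by auto
  have vs: "p \<in> arm_V r" "p' \<in> arm_V r" if "y = arm_l r i" "1 \<le> i" for i
  proof -
    have "i = k \<or> i = k + 1" using arm_l_between[of k i] * that by simp
    then show "p \<in> arm_V r" using * that unfolding arm_V_def by blast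
    show "p' \<in> arm_V r" using * that unfolding arm_V_def by blast
  qed
  then show ?thesis using arm_V_D(2)[of _ y] * y0 by metis
qed

lemma arm_glue_star_V:
  assumes "(p, p') \<in> (arm_glue r \<union> (arm_glue r)\<inverse>)\<^sup>*"
  shows "p \<in> arm_V r \<longleftrightarrow> p' \<in> arm_V r"
  using assms by (induction rule: rtrancl_induct) (auto dest: arm_glue_V_iff)

lemma sym_arm_glue_star: "sym ((arm_glue r \<union> (arm_glue r)\<inverse>)\<^sup>*)"
  by (intro sym_rtrancl) (auto simp: sym_def)

lemma equiv_arm_rel: "equiv (arm_P r) (arm_rel r)"
proof (rule equivI)
  show "arm_rel r \<subseteq> arm_P r \<times> arm_P r" by (auto simp: arm_rel_def)
  show "refl_on (arm_P r) (arm_rel r)" by (auto simp: refl_on_def arm_rel_def)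
  show "sym (arm_rel r)"
    using sym_arm_glue_star by (auto simp: sym_def arm_rel_def)
  show "trans (arm_rel r)"
    by (rule transI) (auto simp: arm_rel_def dest: arm_glue_star_V intro: rtrancl_trans)
qed

lemma arm_cls_eq_iff:
  "p \<in> arm_P r \<Longrightarrow> p' \<in> arm_P r \<Longrightarrow> arm_cls r p = arm_cls r p' \<longleftrightarrow> (p, p') \<in> arm_rel r"
  unfolding arm_cls_def using eq_equiv_class_iff[OF equiv_arm_rel] by blast

lemma arm_cls_self: "p \<in> arm_P r \<Longrightarrow> p \<in> arm_cls r p"
  unfolding arm_cls_def using equiv_class_self[OF equiv_arm_rel] by blast

lemma arm_cls_in_X: "p \<in> arm_P r \<Longrightarrow> arm_cls r p \<in> arm_X r"
  unfolding arm_cls_def arm_X_def by (rule quotientI)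

lemma arm_X_eq: "arm_X r = arm_cls r ` arm_P r"
  unfolding arm_X_def arm_cls_def quotient_def by auto

lemma arm_cls_V: "p \<in> arm_V r \<Longrightarrow> arm_cls r p = arm_V r"
  using arm_V_subset_P arm_glue_star_V unfolding arm_cls_def arm_rel_def by blast

lemma arm_cls_glue: "(p, p') \<in> arm_glue r \<Longrightarrow> arm_cls r p = arm_cls r p'"
  using arm_glue_subset_P[of p p'] by (subst arm_cls_eq_iff) (auto simp: arm_rel_def)

lemma arm_cls_in_Xreg: "p \<in> arm_P r \<Longrightarrow> p \<notin> arm_V r \<Longrightarrow> arm_cls r p \<in> arm_Xreg r"
  using arm_cls_self[of p] arm_cls_in_X[of p] unfolding arm_Xreg_def arm_sing_def by auto

text \<open>Saturation principle: invariance has to be checked only across single gluings at regular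
  points, because a chain of gluings that starts at a regular point never meets a vertex.\<close>

lemma arm_rel_induct:
  assumes rel: "(p, p') \<in> arm_rel r" and "p \<notin> arm_V r" "p \<in> S"
    and step: "\<And>a b. (a, b) \<in> arm_glue r \<Longrightarrow> a \<notin> arm_V r \<Longrightarrow> a \<in> S \<longleftrightarrow> b \<in> S"
  shows "p' \<in> S" and "p' \<notin> arm_V r"
proof -
  have "(p, p') \<in> (arm_glue r \<union> (arm_glue r)\<inverse>)\<^sup>*"
    using rel \<open>p \<notin> arm_V r\<close> by (auto simp: arm_rel_def)
  then have "p' \<in> S \<and> p' \<notin> arm_V r"
  proof (induction rule: rtrancl_induct)
    case (step y z)
    then show ?case using assms(4)[of y z] assms(4)[of z y] arm_glue_V_iff[of y z] arm_glue_V_iff[of z y]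
      by auto
  qed (use assms in auto)
  then show "p' \<in> S" and "p' \<notin> arm_V r" by auto
qed

section \<open>Saturated sets and the quotient topology\<close>

lemma Union_arm_X: "\<Union>(arm_X r) = arm_P r"
  unfolding arm_X_def using Union_quotient[OF equiv_arm_rel] .

lemma arm_cls_of_mem: "A \<in> arm_X r \<Longrightarrow> p \<in> A \<Longrightarrow> arm_cls r p = A"
proof -
  assume "A \<in> arm_X r" "p \<in> A"
  then obtain p' where "A = arm_cls r p'" by (auto simp: arm_X_eq)
  with \<open>p \<in> A\<close> show ?thesis
    using equiv_class_eq[OF equiv_arm_rel, of p' p] by (simp add: arm_cls_def)
qed

lemma mem_Union_iff:
  assumes "U \<subseteq> arm_X r"
  shows "p \<in> \<Union>U \<longleftrightarrow> p \<in> arm_P r \<and> arm_cls r p \<in> U"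
proof
  assume "p \<in> \<Union>U"
  then obtain A where "A \<in> U" "p \<in> A" by auto
  moreover have "A \<in> arm_X r" using assms \<open>A \<in> U\<close> by auto
  ultimately show "p \<in> arm_P r \<and> arm_cls r p \<in> U"
    using arm_cls_of_mem[of A p] Union_arm_X by auto
next
  assume "p \<in> arm_P r \<and> arm_cls r p \<in> U"
  then show "p \<in> \<Union>U" using arm_cls_self[of p] by blast
qed

lemma istopology_arm:
  "istopology (\<lambda>U. U \<subseteq> arm_X r \<and> openin (top_of_set (arm_P r)) (\<Union>U))"
  unfolding istopology_def
proof (intro conjI allI impI)
  fix S T assume S: "S \<subseteq> arm_X r \<and> openin (top_of_set (arm_P r)) (\<Union>S)"
    and T: "T \<subseteq> arm_X r \<and> openin (top_of_set (arm_P r)) (\<Union>T)"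
  show "S \<inter> T \<subseteq> arm_X r" using S by auto
  then have "\<Union>(S \<inter> T) = \<Union>S \<inter> \<Union>T"
    using S T mem_Union_iff[of S] mem_Union_iff[of T] mem_Union_iff[of "S \<inter> T"] by (intro set_eqI) auto
  then show "openin (top_of_set (arm_P r)) (\<Union>(S \<inter> T))" using S T by auto
next
  fix \<K> assume *: "\<forall>K\<in>\<K>. K \<subseteq> arm_X r \<and> openin (top_of_set (arm_P r)) (\<Union>K)"
  then show "\<Union>\<K> \<subseteq> arm_X r" by auto
  have "\<Union>(\<Union>\<K>) = \<Union>(Union ` \<K>)" by auto
  moreover have "openin (top_of_set (arm_P r)) (\<Union>(Union ` \<K>))"
    using * by (intro openin_Union) auto
  ultimately show "openin (top_of_set (arm_P r)) (\<Union>(\<Union>\<K>))" by simp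
qed

lemma openin_arm_top:
  "openin (arm_top r) U \<longleftrightarrow> U \<subseteq> arm_X r \<and> openin (top_of_set (arm_P r)) (\<Union>U)"
  unfolding arm_top_def using topology_inverse'[OF istopology_arm] by simp

lemma topspace_arm_top: "topspace (arm_top r) = arm_X r"
proof
  have "openin (arm_top r) (arm_X r)"
    using Union_arm_X by (simp add: openin_arm_top)
  then show "arm_X r \<subseteq> topspace (arm_top r)" by (rule openin_subset)
  show "topspace (arm_top r) \<subseteq> arm_X r"
    using openin_topspace[of "arm_top r"] openin_arm_top by blast
qed

lemma closedin_arm_top:
  assumes "D \<subseteq> arm_X r" "closedin (top_of_set (arm_P r)) (\<Union>D)"
  shows "closedin (arm_top r) D"
proof -
  have "\<Union>(arm_X r - D) = arm_P r - \<Union>D"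
    using mem_Union_iff[of D] mem_Union_iff[of "arm_X r - D"] assms(1) arm_cls_in_X
    by (intro set_eqI) auto
  then show ?thesis
    using assms by (auto simp: closedin_def topspace_arm_top openin_arm_top)
qed

lemma continuous_map_arm_cls: "continuous_map (top_of_set (arm_P r)) (arm_top r) (arm_cls r)"
  unfolding continuous_map_def
proof (intro conjI allI impI)
  show "arm_cls r \<in> topspace (top_of_set (arm_P r)) \<rightarrow> topspace (arm_top r)"
    using arm_cls_in_X by (auto simp: topspace_arm_top)
  fix U assume U: "openin (arm_top r) U"
  then have "{x \<in> topspace (top_of_set (arm_P r)). arm_cls r x \<in> U} = \<Union>U"
    using mem_Union_iff[of U] by (auto simp: openin_arm_top)
  then show "openin (top_of_set (arm_P r)) {x \<in> topspace (top_of_set (arm_P r)). arm_cls r x \<in> U}"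
    using U by (simp add: openin_arm_top)
qed

lemma arm_s_eq: "arm_s r k = (1 - r ^ k) / (1 - r)"
proof (induction k)
  case (Suc k)
  have "1 - r \<noteq> 0" using r_less_1 by simp
  then show ?case unfolding arm_s_Suc Suc by (simp add: divide_simps) (simp add: algebra_simps)
qed simp

text \<open>The limit point of the squares does not belong to \<^term>\<open>arm_P r\<close>, so the vertices
  accumulate only at the vertex at the origin.\<close>

lemma closedin_arm_V: "closedin (top_of_set (arm_P r)) (arm_V r)"
proof -
  let ?s = "1 / (1 - r)"
  have pow: "(\<lambda>k. r ^ k) \<longlonglongrightarrow> 0"
    using r_pos r_less_1 LIMSEQ_realpow_zero[of r] by simp
  have s: "arm_s r \<longlonglongrightarrow> ?s"
    using tendsto_divide[OF tendsto_diff[OF tendsto_const pow] tendsto_const[of "1 - r"], of 1] r_less_1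
    by (simp add: arm_s_eq[abs_def])
  have l: "(\<lambda>k. arm_l r (k + 1)) \<longlonglongrightarrow> 0"
    using pow by (simp add: arm_l_def)
  have s': "(\<lambda>k. arm_s r (k + 1)) \<longlonglongrightarrow> ?s"
    using s by (rule LIMSEQ_ignore_initial_segment)
  \<comment> \<open>The families whose index starts at 1 are shifted to become sequences; each of
    the four sequences together with its limit is compact.\<close>
  let ?A = "insert (?s, 0) (range (\<lambda>k. (arm_s r k, 0))) \<union>
            insert (?s, 0) (range (\<lambda>k. (arm_s r (k + 1), arm_l r (k + 1)))) \<union>
            insert (?s, 0) (range (\<lambda>k. (arm_s r k, arm_l r (k + 1)))) \<union>
            insert (0, 0) (range (\<lambda>k. (0, arm_l r (k + 1))))"
  have "compact ?A"
    by (intro compact_Un compact_sequence_with_limit tendsto_Pair s s' l tendsto_const)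
  then have cl: "closed ?A" by (rule compact_imp_closed)
  have notin: "(?s, 0) \<notin> arm_P r"
  proof
    assume "(?s, 0) \<in> arm_P r"
    then obtain k where "?s \<le> arm_s r k" by (auto simp: arm_P_def arm_square_def)
    then show False using r_less_1 zero_less_power[OF r_pos, of k] by (simp add: arm_s_eq field_simps)
  qed
  have eq: "?A = insert (?s, 0) (arm_V r)"
  proof -
    have zero: "(0, 0) \<in> {(arm_s r k, 0 :: real) | k. True}"
      by (intro CollectI exI[of _ 0]) simp
    have shift: "range (\<lambda>k. g (k + 1)) = {g k | k. k \<ge> 1}" for g :: "nat \<Rightarrow> real \<times> real"
    proof -
      have "\<exists>k. n = k + 1" if "1 \<le> n" for n :: nat using that by presburger
      then show ?thesis by force
    qed
    have all: "range g = {g k | k. True}" for g :: "nat \<Rightarrow> real \<times> real"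
      by (simp add: full_SetCompr_eq)
    have "insert s S1 \<union> insert s S2 \<union> insert s S3 \<union> insert z S4 = insert s (S1 \<union> S2 \<union> S3 \<union> S4)"
      if "z \<in> S1" for s z and S1 S2 S3 S4 :: "(real \<times> real) set"
      using that by blast
    from this[OF zero] show ?thesis
      unfolding arm_V_def shift[of "\<lambda>k. (arm_s r k, arm_l r k)"] shift[of "\<lambda>k. (0, arm_l r k)"]
      unfolding all .
  qed
  have "arm_P r \<inter> insert (?s, 0) (arm_V r) = arm_V r"
    using arm_V_subset_P notin by (simp add: Int_absorb1)
  then show ?thesis
    using closedin_closed_Int[OF cl[unfolded eq], of "arm_P r"] by simp
qed

end

subsection \<open>The linear foliation on the first two squares\<close>

locale armadillo_inv =
  fixes q :: nat and r :: real
  assumes q_ge: "2 \<le> q" and r_eq: "r = 1 / real q"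
begin

lemma Q_ge: "2 \<le> real q"
  using q_ge by simp

lemma Q_r: "real q * r = 1"
  using Q_ge by (simp add: r_eq)

lemma r_gt_0: "0 < r" and r_le_half: "r \<le> 1 / 2"
  using Q_ge by (simp_all add: r_eq field_simps)

sublocale armadillo r
  using r_gt_0 r_le_half by unfold_locales auto

lemma Q_r2: "real q * r\<^sup>2 = r"
  using Q_r by (simp add: power2_eq_square mult.assoc[symmetric])

lemma r2_pos: "0 < r\<^sup>2"
  using r_gt_0 by simp

lemma arm_l_simps [simp]: "arm_l r (Suc 0) = 1" "arm_l r 2 = r" "arm_l r 3 = r\<^sup>2"
  by (simp_all add: arm_l_def)

lemma arm_s_simps [simp]: "arm_s r (Suc 0) = 1" "arm_s r 2 = 1 + r"
  using arm_s_Suc[of 0] arm_s_Suc[of 1] by (simp_all add: numeral_2_eq_2)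

lemma arm_s_ge: "2 \<le> k \<Longrightarrow> 1 + r \<le> arm_s r k"
  using arm_s_le_iff[of 2 k] by (simp only: arm_s_simps)

lemma arm_l_le_r2: "3 \<le> k \<Longrightarrow> arm_l r k \<le> r\<^sup>2"
  using arm_l_antimono[of 3 k] by (simp only: arm_l_simps)

text \<open>Scaled so that the level sets have slope q/N and the periods of the unit-square torus
  act by integers: a vertical one adds N, a horizontal one subtracts q. The integer part names the
  strand, the fractional part the leaf.\<close>

definition lev :: "real \<times> real \<Rightarrow> real" where
  "lev p = (2 * real q - 1) * snd p - real q * fst p"

text \<open>Writing N = 2 q - 1, a line of slope q / N through the left edge of the unit square is
  determined by its height (j + c) / N with j an integer and c in [0, 1); on the torus obtained
  from that square its j runs through all residues modulo N.  The excluded values are those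
  congruent to 0 or q, i.e. the two strands that the slit leading into the second square
  cuts out of the closed orbit.\<close>

definition strands :: "int set" where
  "strands = {- int q..2 * int q - 2} - {0, int q, 1 - int q}"

definition leaf :: "real \<Rightarrow> (real \<times> real) set" where
  "leaf c = {p \<in> arm_P r. \<exists>j\<in>strands. lev p = of_int j + c}"

lemma leafI: "p \<in> arm_P r \<Longrightarrow> j \<in> strands \<Longrightarrow> lev p = of_int j + c \<Longrightarrow> p \<in> leaf c"
  by (auto simp: leaf_def)

lemma leaf_subset_P: "leaf c \<subseteq> arm_P r"
  by (auto simp: leaf_def)

lemma int_ge: "real_of_int a - 1 < real_of_int j \<Longrightarrow> a \<le> j" for a j :: int
  by linarith

lemma int_plus_frac_cancel:
  assumes "of_int j + c = of_int k + (d :: real)" "0 \<le> c" "c < 1" "0 \<le> d" "d < 1"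
  shows "j = k" "c = d"
proof -
  show "j = k" using assms by linarith
  then show "c = d" using assms(1) by simp
qed

lemma arm_P_cases:
  assumes "(x, y) \<in> arm_P r"
  obtains (first) "0 \<le> x" "x \<le> 1" "0 \<le> y" "y \<le> 1"
  | (second) "1 \<le> x" "x \<le> 1 + r" "0 \<le> y" "y \<le> r"
  | (rest) "1 + r \<le> x" "0 \<le> y" "y \<le> r\<^sup>2"
proof -
  obtain k where k: "1 \<le> k" "arm_s r (k - 1) \<le> x" "x \<le> arm_s r k" "0 \<le> y" "y \<le> arm_l r k"
    using assms by (auto simp: arm_P_def arm_square_def)
  consider "k = 1" | "k = 2" | "3 \<le> k" using k(1) by linarith
  then show ?thesis
  proof cases
    case 3
    then have "1 + r \<le> arm_s r (k - 1)" "arm_l r k \<le> r\<^sup>2"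
      by (auto intro: arm_s_ge arm_l_le_r2)
    then show ?thesis using k rest by simp
  qed (use k first second in auto)
qed

lemma first_in_P: "0 \<le> x \<Longrightarrow> x \<le> 1 \<Longrightarrow> 0 \<le> y \<Longrightarrow> y \<le> 1 \<Longrightarrow> (x, y) \<in> arm_P r"
  by (rule arm_P_I[of 1]) auto

lemma second_in_P: "1 \<le> x \<Longrightarrow> x \<le> 1 + r \<Longrightarrow> 0 \<le> y \<Longrightarrow> y \<le> r \<Longrightarrow> (x, y) \<in> arm_P r"
  by (rule arm_P_I[of 2]) auto

text \<open>From the third square on, N y <= N r^2 = 2r - r^2 < 1 while q x >= q + 1, so all these
  points lie below the lowest strand -q.\<close>

lemma lev_rest_less:
  assumes "1 + r \<le> x" "y \<le> r\<^sup>2"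
  shows "lev (x, y) < - real q"
proof -
  have "(2 * real q - 1) * y \<le> (2 * real q - 1) * r\<^sup>2"
    using assms Q_ge by (intro mult_left_mono) auto
  also have "\<dots> = 2 * r - r\<^sup>2" using Q_r2 by (simp add: algebra_simps)
  finally have 1: "(2 * real q - 1) * y \<le> 2 * r - r\<^sup>2" .
  have "real q * (1 + r) \<le> real q * x" using assms by (intro mult_left_mono) auto
  then have "real q + 1 \<le> real q * x" using Q_r by (simp add: algebra_simps)
  then show ?thesis unfolding lev_def fst_conv snd_conv using 1 r_le_half r2_pos by linarith
qed

lemma lev_low_not_leaf: "lev p < - real q \<Longrightarrow> 0 \<le> c \<Longrightarrow> p \<notin> leaf c"
proof
  assume *: "lev p < - real q" "0 \<le> c" "p \<in> leaf c"
  then obtain j where "j \<in> strands" "lev p = of_int j + c" by (auto simp: leaf_def)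
  then have "real_of_int j < real_of_int (- int q)" "- int q \<le> j"
    using * by (simp_all add: strands_def)
  then show False by linarith
qed

text \<open>For x >= 1 and y <= r the level is at most 2 - r - q, which leaves j = -q and j = 1 - q;
  the latter is the omitted copy of q modulo N.\<close>

lemma second_leaf:
  assumes "1 \<le> x" "0 \<le> y" "y \<le> r" "0 \<le> c" "j \<in> strands" "lev (x, y) = of_int j + c"
    and "c \<le> 1 - r"
  shows "j = - int q"
proof -
  have "(2 * real q - 1) * y \<le> (2 * real q - 1) * r"
    using assms Q_ge by (intro mult_left_mono) auto
  also have "\<dots> = 2 - r" using Q_r by (simp add: algebra_simps)
  finally have "(2 * real q - 1) * y \<le> 2 - r" .
  moreover have "real q * 1 \<le> real q * x" using assms by (intro mult_left_mono) auto
  ultimately have "of_int j + c \<le> 2 - r - real q" using assms by (simp add: lev_def)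
  then have "real_of_int j < real_of_int (2 - int q)" using assms r_gt_0 by simp
  then have "j < 2 - int q" by linarith
  then show ?thesis using assms(5) by (auto simp: strands_def)
qed

text \<open>On the line x = 1 the part y <= r is assigned to the second square; the part above the
  slit, which is glued back to the left side, is the separate case \<open>edge\<close>.\<close>

lemma leaf_cases:
  assumes "(x, y) \<in> leaf c" "0 \<le> c" "c \<le> 1 - r"
  obtains (first) j where "j \<in> strands" "lev (x, y) = of_int j + c" "0 \<le> x" "x < 1" "0 \<le> y" "y \<le> 1"
  | (edge) j where "j \<in> strands" "lev (x, y) = of_int j + c" "x = 1" "r < y" "y \<le> 1"
  | (second) "1 \<le> x" "x \<le> 1 + r" "0 \<le> y" "y \<le> r" "lev (x, y) = - real q + c"
proof -
  obtain j where j: "j \<in> strands" "lev (x, y) = of_int j + c" and P: "(x, y) \<in> arm_P r"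
    using assms by (auto simp: leaf_def)
  have second': thesis if "1 \<le> x" "x \<le> 1 + r" "0 \<le> y" "y \<le> r"
    using second_leaf[OF that(1,3,4) assms(2) j assms(3)] j that second by auto
  from P show ?thesis
  proof (cases rule: arm_P_cases)
    case first': first
    consider "x < 1" | "x = 1" "r < y" | "x = 1" "y \<le> r" using first' by linarith
    then show ?thesis using first first' j edge second' r_gt_0 by cases auto
  next
    case second
    then show ?thesis by (rule second')
  next
    case rest
    then show ?thesis using lev_rest_less lev_low_not_leaf assms by blast
  qed
qed

lemma leaf_subset_squares:
  assumes "0 \<le> c" "c \<le> 1 - r"
  shows "leaf c \<subseteq> arm_square r 1 \<union> arm_square r 2"
proof
  fix p assume "p \<in> leaf c"
  then have "(fst p, snd p) \<in> leaf c" by simp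
  then show "p \<in> arm_square r 1 \<union> arm_square r 2"
    using assms r_gt_0 by (cases rule: leaf_cases) (auto simp: arm_square_def mem_Times_iff)
qed

section \<open>Invariance of the leaves under each gluing\<close>

lemma lev_left: "lev (0, y) = (2 * real q - 1) * y"
  by (simp add: lev_def)

text \<open>The index j changes by N. This is why \<open>strands\<close> omits 1 - q = q - N
  together with q.\<close>

lemma leaf_glue_first_top:
  assumes "0 < x" "x < 1" "0 \<le> c" "c < 1"
  shows "(x, 1) \<in> leaf c \<longleftrightarrow> (x, 0) \<in> leaf c"
proof -
  have P: "(x, 1) \<in> arm_P r" "(x, 0) \<in> arm_P r" using assms first_in_P by auto
  have x: "0 < real q * x" "real q * x < real q" using assms Q_ge by auto
  have lev: "lev (x, 1) = lev (x, 0) + of_int (2 * int q - 1)" "lev (x, 0) = - (real q * x)"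
    by (simp_all add: lev_def)
  show ?thesis
  proof
    assume "(x, 1) \<in> leaf c"
    then obtain j where j: "j \<in> strands" "lev (x, 0) = of_int (j - (2 * int q - 1)) + c"
      using lev by (auto simp: leaf_def)
    have "- int q \<le> j - (2 * int q - 1)" using j lev x assms by (intro int_ge) simp
    moreover have "real_of_int (j - (2 * int q - 1)) < 0" using j lev x assms by linarith
    ultimately have "j - (2 * int q - 1) \<in> strands" using j(1) q_ge by (auto simp: strands_def)
    then show "(x, 0) \<in> leaf c" using j P by (intro leafI) auto
  next
    assume "(x, 0) \<in> leaf c"
    then obtain j where j: "j \<in> strands" "lev (x, 0) = of_int j + c"
      by (auto simp: leaf_def)
    have "real_of_int j < 0" using j lev x assms by linarith
    then have "j + (2 * int q - 1) \<in> strands" using j(1) q_ge by (auto simp: strands_def)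
    moreover have "lev (x, 1) = of_int (j + (2 * int q - 1)) + c" using j lev by simp
    ultimately show "(x, 1) \<in> leaf c" using P by (intro leafI) auto
  qed
qed

text \<open>The index j changes by q. Above the slit the left edge carries only strands with 2 <= j
  <= 2q - 2, so the shift matches the omitted 0 with the omitted q and cannot reach the omitted 1 -
  q, which would come from j = 1.\<close>

lemma leaf_glue_first_side:
  assumes "r < y" "y < 1" "0 \<le> c" "c \<le> 1 - r"
  shows "(1, y) \<in> leaf c \<longleftrightarrow> (0, y) \<in> leaf c"
proof -
  have P: "(1, y) \<in> arm_P r" "(0, y) \<in> arm_P r" using assms first_in_P r_gt_0 by auto
  have "(2 * real q - 1) * r < (2 * real q - 1) * y" "(2 * real q - 1) * y < (2 * real q - 1) * 1"
    using assms Q_ge by auto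
  moreover have "(2 * real q - 1) * r = 2 - r" using Q_r by (simp add: algebra_simps)
  ultimately have y: "2 - r < lev (0, y)" "lev (0, y) < of_int (2 * int q - 1)" by (simp_all add: lev_left)
  have lev: "lev (1, y) = lev (0, y) - of_int (int q)"
    by (simp add: lev_def)
  have bounds: "2 \<le> j" "j \<le> 2 * int q - 2" if "lev (0, y) = of_int j + c" for j
  proof -
    show "2 \<le> j" using y that assms by (intro int_ge) simp
    have "real_of_int j < of_int (2 * int q - 1)" using y that assms by linarith
    then show "j \<le> 2 * int q - 2" by linarith
  qed
  show ?thesis
  proof
    assume "(1, y) \<in> leaf c"
    then obtain j where j: "j \<in> strands" "lev (0, y) = of_int (j + int q) + c"
      using lev by (auto simp: leaf_def)
    have "j + int q \<in> strands" using j(1) bounds[OF j(2)] q_ge by (auto simp: strands_def)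
    then show "(0, y) \<in> leaf c" using j P by (intro leafI) auto
  next
    assume "(0, y) \<in> leaf c"
    then obtain j where j: "j \<in> strands" "lev (0, y) = of_int j + c"
      by (auto simp: leaf_def)
    have "j - int q \<in> strands" using j(1) bounds[OF j(2)] q_ge by (auto simp: strands_def)
    moreover have "lev (1, y) = of_int (j - int q) + c" using j lev by simp
    ultimately show "(1, y) \<in> leaf c" using P by (intro leafI) auto
  qed
qed

text \<open>Here the gluing would destroy c, so the leaf has to miss the edge: on the open bottom
  edge the level is below -q, and on the open top edge it exceeds 1 - r - q, the largest value of -q
  + c. The bound c <= 1 - r comes from this.\<close>

lemma leaf_glue_second_top:
  assumes "1 < x" "x < 1 + r" "0 \<le> c" "c \<le> 1 - r"
  shows "(x, r) \<notin> leaf c" "(x, 0) \<notin> leaf c"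
proof -
  have "real q * 1 < real q * x" "real q * x < real q * (1 + r)"
    using assms Q_ge by auto
  then have x: "real q < real q * x" "real q * x < real q + 1" using Q_r by (simp_all add: algebra_simps)
  then show "(x, 0) \<notin> leaf c" using assms by (intro lev_low_not_leaf) (simp_all add: lev_def)
  show "(x, r) \<notin> leaf c"
  proof
    assume "(x, r) \<in> leaf c"
    then obtain j where j: "j \<in> strands" "lev (x, r) = of_int j + c" by (auto simp: leaf_def)
    then have "j = - int q"
      using second_leaf[of x r c j] assms r_gt_0 by auto
    moreover have "lev (x, r) = 2 - r - real q * x" using Q_r by (simp add: lev_def algebra_simps)
    ultimately show False using j x assms by simp
  qed
qed

text \<open>Since q (1 + r) = q + 1, strand -q on the right matches strand 1 on the left. Below
  height r the left edge has levels in (0, 2 - r), where j = 1 is the only choice once 0 is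
  omitted.\<close>

lemma leaf_glue_second_side:
  assumes "r\<^sup>2 < y" "y < r" "0 \<le> c" "c \<le> 1 - r"
  shows "(1 + r, y) \<in> leaf c \<longleftrightarrow> (0, y) \<in> leaf c"
proof -
  have P: "(1 + r, y) \<in> arm_P r" "(0, y) \<in> arm_P r"
    using assms first_in_P[of 0 y] second_in_P[of "1 + r" y] r_gt_0 r2_pos r_le_half by auto
  have "(2 * real q - 1) * y < (2 * real q - 1) * r" "0 < y"
    using assms Q_ge order.strict_trans[OF r2_pos] by auto
  moreover have "(2 * real q - 1) * r = 2 - r" using Q_r by (simp add: algebra_simps)
  ultimately have y: "0 < lev (0, y)" "lev (0, y) < 2 - r" using Q_ge by (simp_all add: lev_left)
  have lev: "lev (1 + r, y) = lev (0, y) - real q - 1"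
    using Q_r by (simp add: lev_def algebra_simps)
  show ?thesis
  proof
    assume "(1 + r, y) \<in> leaf c"
    then obtain j where j: "j \<in> strands" "lev (1 + r, y) = of_int j + c"
      by (auto simp: leaf_def)
    then have "j = - int q" using second_leaf[of "1 + r" y c j] assms r_gt_0 r2_pos by auto
    then have "lev (0, y) = of_int 1 + c" using j lev by simp
    moreover have "1 \<in> strands" using q_ge by (auto simp: strands_def)
    ultimately show "(0, y) \<in> leaf c" using P by (intro leafI) auto
  next
    assume "(0, y) \<in> leaf c"
    then obtain j where j: "j \<in> strands" "lev (0, y) = of_int j + c"
      by (auto simp: leaf_def)
    have "0 \<le> j" using y j assms r_gt_0 by (intro int_ge) simp
    moreover have "real_of_int j < 2" using y j assms r_gt_0 by linarith
    ultimately have "j = 1" using j(1) by (auto simp: strands_def)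
    then have "lev (1 + r, y) = of_int (- int q) + c" using j lev by simp
    moreover have "- int q \<in> strands" using q_ge by (auto simp: strands_def)
    ultimately show "(1 + r, y) \<in> leaf c" using P by (intro leafI) auto
  qed
qed

text \<open>The side gluings from the third square on arrive at heights up to r^2 on the left edge,
  where the levels lie in [0, 1) and only the omitted strand 0 would pass.\<close>

lemma left_low_not_leaf:
  assumes "0 \<le> y" "y \<le> r\<^sup>2" "0 \<le> c" "c \<le> 1 - r"
  shows "(0, y) \<notin> leaf c"
proof
  assume "(0, y) \<in> leaf c"
  then obtain j where j: "j \<in> strands" "lev (0, y) = of_int j + c"
    by (auto simp: leaf_def)
  have "(2 * real q - 1) * y \<le> (2 * real q - 1) * r\<^sup>2" "0 \<le> (2 * real q - 1) * y"
    using assms Q_ge by (auto intro: mult_left_mono)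
  moreover have "(2 * real q - 1) * r\<^sup>2 = 2 * r - r\<^sup>2" using Q_r2 by (simp add: algebra_simps)
  ultimately have y: "0 \<le> lev (0, y)" "lev (0, y) < 1"
    unfolding lev_left using r_le_half r2_pos by linarith+
  have "0 \<le> j" using y j assms r_gt_0 by (intro int_ge) simp
  moreover have "real_of_int j < 1" using y j assms by linarith
  ultimately show False using j(1) by (auto simp: strands_def)
qed

lemma leaf_glue:
  assumes "(p, p') \<in> arm_glue r" "p \<notin> arm_V r" "0 \<le> c" "c \<le> 1 - r"
  shows "p \<in> leaf c \<longleftrightarrow> p' \<in> leaf c"
  using assms(1) unfolding arm_glue_def
proof
  assume "(p, p') \<in> {((x, arm_l r k), (x, 0)) |x k.
      1 \<le> k \<and> arm_s r (k - 1) \<le> x \<and> x \<le> arm_s r k}"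
  then obtain x k where *: "p = (x, arm_l r k)" "p' = (x, 0)" "1 \<le> k" "arm_s r (k - 1) \<le> x" "x \<le> arm_s r k"
    by auto
  have "p' \<notin> arm_V r" using assms arm_glue_V_iff by auto
  then have "x \<noteq> arm_s r i" for i using * by (auto simp: arm_V_def)
  then have x: "arm_s r (k - 1) < x" "x < arm_s r k" using * by (auto simp: less_le)
  consider "k = 1" | "k = 2" | "3 \<le> k" using *(3) by linarith
  then show ?thesis
  proof cases
    case 1
    then show ?thesis using leaf_glue_first_top[of x c] x * assms r_gt_0 by auto
  next
    case 2
    then show ?thesis using leaf_glue_second_top[of x c] x * assms by auto
  next
    case 3
    then have "1 + r \<le> arm_s r (k - 1)" "arm_l r k \<le> r\<^sup>2"
      by (auto intro: arm_s_ge arm_l_le_r2)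
    then have "lev p < - real q" "lev p' < - real q"
      using lev_rest_less[of x "arm_l r k"] lev_rest_less[of x 0] x * by auto
    then show ?thesis using lev_low_not_leaf assms by blast
  qed
next
  assume "(p, p') \<in> {((arm_s r k, y), (0, y)) |y k.
      1 \<le> k \<and> arm_l r (k + 1) \<le> y \<and> y \<le> arm_l r k}"
  then obtain y k where *: "p = (arm_s r k, y)" "p' = (0, y)" "1 \<le> k" "arm_l r (k + 1) \<le> y" "y \<le> arm_l r k"
    by auto
  have "y \<noteq> arm_l r k" using assms(2) * by (auto simp: arm_V_def)
  moreover have "y \<noteq> arm_l r (k + 1)" using assms(2) * unfolding arm_V_def by blast
  ultimately have y: "arm_l r (k + 1) < y" "y < arm_l r k" using * by (auto simp: less_le)
  consider "k = 1" | "k = 2" | "3 \<le> k" using *(3) by linarith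
  then show ?thesis
  proof cases
    case 1
    then show ?thesis using leaf_glue_first_side[of y c] y * assms by (auto simp: numeral_2_eq_2[symmetric])
  next
    case 2
    then show ?thesis using leaf_glue_second_side[of y c] y * assms by (auto simp: numeral_3_eq_3[symmetric] numeral_2_eq_2[symmetric])
  next
    case 3
    then have "1 + r \<le> arm_s r k" "arm_l r k \<le> r\<^sup>2" "0 < arm_l r (k + 1)"
      by (auto intro: arm_s_ge arm_l_le_r2 arm_l_pos)
    then have "lev p < - real q" "p' \<notin> leaf c"
      using lev_rest_less[of "arm_s r k" y] left_low_not_leaf[of y c] y * assms by auto
    then show ?thesis using lev_low_not_leaf assms by blast
  qed
qed

lemma leaf_rel:
  assumes "(p, p') \<in> arm_rel r" "p \<notin> arm_V r" "p \<in> leaf c" "0 \<le> c" "c \<le> 1 - r"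
  shows "p' \<in> leaf c"
  using arm_rel_induct(1)[OF assms(1,2,3)] leaf_glue assms(4,5) by blast

text \<open>The levels of the vertices are computed one by one; the unlisted ones lie below -q or on
  a level whose integer part is not in \<open>strands\<close>. Hence leaves with 0 < c < 1 - r are
  regular and only the two extreme ones can meet the singularity.\<close>

lemma leaf_V:
  assumes "p \<in> arm_V r" "p \<in> leaf c" "0 \<le> c" "c \<le> 1 - r"
  shows "c = 0 \<and> p \<in> {(1, 0), (1, 1)} \<or> c = 1 - r \<and> p \<in> {(0, r), (1 + r, r)}"
proof -
  obtain j where j: "j \<in> strands" "lev p = of_int j + c" using assms by (auto simp: leaf_def)
  have c: "0 \<le> c" "c < 1" "0 \<le> 1 - r" "1 - r < 1" using assms r_gt_0 r_le_half by auto
  have j_eq: "j = k \<and> c = d" if "lev p = of_int k + d" "0 \<le> d" "d < 1" for k d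
    using int_plus_frac_cancel[of j c k d] that j c by auto
  have low: "\<not> lev p < - real q" using lev_low_not_leaf assms by blast
  have Qr: "(2 * real q - 1) * r = 2 - r" using Q_r by (simp add: algebra_simps)
  have base: ?thesis if "p = (arm_s r i, 0)" for i
  proof -
    consider "i = 0" | "i = 1" | "2 \<le> i" by linarith
    then show ?thesis
    proof cases
      case 1
      then have "lev p = of_int 0 + 0" using that by (simp add: lev_def)
      then show ?thesis using j_eq j(1) by (auto simp: strands_def)
    next
      case 2
      then have "lev p = of_int (- int q) + 0" using that by (simp add: lev_def)
      then show ?thesis using j_eq[of "- int q" 0] that 2 by auto
    next
      case 3
      then have "1 + r \<le> arm_s r i" by (rule arm_s_ge)
      then show ?thesis using low lev_rest_less[of "arm_s r i" 0] that by simp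
    qed
  qed
  \<comment> \<open>The bounds i <= k <= i + 1 cover both kinds of upper vertices, (s_i, l_i) and
    (s_i, l_(i+1)).\<close>
  have upper: ?thesis if p: "p = (arm_s r i, arm_l r k)" and k: "1 \<le> k" "i \<le> k" "k \<le> i + 1" for i k
  proof -
    consider "i = 0" "k = 1" | "i = 1" "k = 1" | "i = 1" "k = 2" | "i = 2" "k = 2" | "2 \<le> i" "3 \<le> k"
      using k by linarith
    then show ?thesis
    proof cases
      case 1
      then have "lev p = of_int (2 * int q - 1) + 0" using p by (simp add: lev_def)
      then show ?thesis using j_eq[of "2 * int q - 1" 0] j(1) by (auto simp: strands_def)
    next
      case 2
      then have "lev p = of_int (int q - 1) + 0" using p by (simp add: lev_def)
      then show ?thesis using j_eq[of "int q - 1" 0] p 2 by auto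
    next
      case 3
      then have "lev p = of_int (1 - int q) + (1 - r)" using p Qr by (simp add: lev_def)
      then show ?thesis using j_eq[of "1 - int q" "1 - r"] c j(1) by (auto simp: strands_def)
    next
      case 4
      then have "lev p = of_int (- int q) + (1 - r)" using p Qr Q_r by (simp add: lev_def algebra_simps)
      then show ?thesis using j_eq[of "- int q" "1 - r"] c p 4 by auto
    next
      case 5
      then have "1 + r \<le> arm_s r i" "arm_l r k \<le> r\<^sup>2" by (auto intro: arm_s_ge arm_l_le_r2)
      then show ?thesis using low lev_rest_less[of "arm_s r i" "arm_l r k"] p by simp
    qed
  qed
  have left: ?thesis if p: "p = (0, arm_l r k)" and k: "1 \<le> k" for k
  proof -
    consider "k = 1" | "k = 2" | "3 \<le> k" using k by linarith
    then show ?thesis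
    proof cases
      case 1
      then show ?thesis using upper[of 0 1] p by simp
    next
      case 2
      then have "lev p = of_int 1 + (1 - r)" using p Qr by (simp add: lev_def)
      then show ?thesis using j_eq[of 1 "1 - r"] c p 2 by auto
    next
      case 3
      then have "arm_l r k \<le> r\<^sup>2" by (rule arm_l_le_r2)
      then show ?thesis using left_low_not_leaf[of "arm_l r k" c] p assms arm_l_pos[of k] by simp
    qed
  qed
  from assms(1) consider k where "p = (arm_s r k, 0)" | k where "p = (arm_s r k, arm_l r k)" "1 \<le> k"
    | k where "p = (arm_s r k, arm_l r (k + 1))" | k where "p = (0, arm_l r k)" "1 \<le> k"
    unfolding arm_V_def by blast
  then show ?thesis
  proof cases
    case 1
    then show ?thesis by (rule base)
  next
    case 2
    then show ?thesis by (rule upper) auto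
  next
    case 3
    then show ?thesis by (rule upper) auto
  next
    case 4
    then show ?thesis by (rule left)
  qed
qed

subsection \<open>Parametrisation of the leaves\<close>

text \<open>After k crossings from strand 1 the strand is 1 + q k modulo N. As 2q = N + 1, doubling
  gives 2 j = k + 2 modulo N, so j is congruent to 0 only for k = N - 2 and to q (or 1 - q) only for
  k = N - 1, modulo N; both are beyond the last crossing k = 2q - 4.\<close>

lemma crossing_index:
  fixes j k n :: int
  assumes "0 \<le> k" "k \<le> 2 * int q - 4" "j = 1 + int q * k - n * (2 * int q - 1)"
  shows "j \<noteq> 0" "j \<noteq> int q" "j \<noteq> 1 - int q"
proof -
  let ?N = "2 * int q - 1"
  have double: "2 * j = k + 2 + ?N * (k - 2 * n)"
    unfolding assms(3) by (simp add: algebra_simps)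
  have nd: "\<not> ?N dvd k + 1" "\<not> ?N dvd k + 2"
    by (rule zdvd_not_zless; use assms in simp)+
  show "j \<noteq> 0"
  proof
    assume "j = 0"
    then have "k + 2 = ?N * (2 * n - k)" using double by (simp add: algebra_simps)
    then show False using nd(2) by (metis dvd_triv_left)
  qed
  show "j \<noteq> int q"
  proof
    assume "j = int q"
    then have "k + 1 = ?N * (1 + 2 * n - k)" using double by (simp add: algebra_simps)
    then show False using nd(1) by (metis dvd_triv_left)
  qed
  show "j \<noteq> 1 - int q"
  proof
    assume "j = 1 - int q"
    then have "k + 1 = ?N * (2 * n - k - 1)" using double by (simp add: algebra_simps)
    then show False using nd(1) by (metis dvd_triv_left)
  qed
qed

text \<open>After at least one crossing the orbit does not come back to strand 1, nor to strand N,
  which is 0 modulo N. With \<open>crossing_index\<close> this puts every later passage through the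
  left edge above the slit.\<close>

lemma crossing_index_pos:
  fixes j k n :: int
  assumes "1 \<le> k" "k \<le> 2 * int q - 4" "j = 1 + int q * k - n * (2 * int q - 1)"
  shows "j \<noteq> 1" "j \<noteq> 2 * int q - 1"
proof -
  let ?N = "2 * int q - 1"
  have double: "2 * j = k + 2 + ?N * (k - 2 * n)"
    unfolding assms(3) by (simp add: algebra_simps)
  have nd: "\<not> ?N dvd k"
    by (rule zdvd_not_zless) (use assms in simp_all)
  show "j \<noteq> 1"
  proof
    assume "j = 1"
    then have "k = ?N * (2 * n - k)" using double by (simp add: algebra_simps)
    then show False using nd by (metis dvd_triv_left)
  qed
  have "j - ?N = 1 + int q * k - (n + 1) * ?N" using assms(3) by (simp add: algebra_simps)
  then have "j - ?N \<noteq> 0" using crossing_index(1)[of k "j - ?N" "n + 1"] assms by simp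
  then show "j \<noteq> 2 * int q - 1" by simp
qed

text \<open>Since 2 is inverse to q modulo N, the congruence j = 1 + q k is solved by k = 2 (j - 1)
  modulo N. The residues N - 2 and N - 1, outside the range for k, belong to the omitted classes of
  0 and q.\<close>

lemma crossing_index_ex:
  fixes j :: int
  assumes "j \<in> strands"
  obtains k n where "0 \<le> k" "k \<le> 2 * int q - 4" "j = 1 + int q * k - n * (2 * int q - 1)"
proof -
  let ?N = "2 * int q - 1"
  define k where "k = (2 * (j - 1)) mod ?N"
  define t where "t = - ((2 * (j - 1)) div ?N)"
  have k_eq: "k = 2 * (j - 1) + t * ?N"
    unfolding k_def t_def by (simp add: minus_div_mult_eq_mod[symmetric])
  have k: "0 \<le> k" "k < ?N" using q_ge by (simp_all add: k_def)
  have "odd ?N" by simp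
  have small: "\<not> ?N dvd i" if "i \<noteq> 0" "- ?N < i" "i < ?N" for i :: int
  proof
    assume "?N dvd i"
    then have "?N \<le> \<bar>i\<bar>" using that by (intro zdvd_imp_le) auto
    then show False using that by auto
  qed
  have "k \<noteq> ?N - 1"
  proof
    assume "k = ?N - 1"
    then have *: "2 * (j - int q) = ?N * (- t)" using k_eq by (simp add: algebra_simps)
    then have "?N dvd 2 * (j - int q)" by (metis dvd_triv_left)
    moreover have "coprime ?N 2" using \<open>odd ?N\<close> by (simp add: coprime_commute)
    ultimately have "?N dvd j - int q" using coprime_dvd_mult_right_iff by blast
    \<comment> \<open>The values of j - q spread over more than N, so besides 0 the multiple -N
      could occur; it is the omitted j = 1 - q.\<close>
    moreover from this have "?N dvd j - int q + ?N" by (intro dvd_add dvd_refl)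
    moreover have "- int q \<le> j" "j \<le> 2 * int q - 2" "j \<noteq> int q" "j - int q + ?N \<noteq> 0"
      using assms by (auto simp: strands_def)
    ultimately show False
      using small[of "j - int q + ?N"] small[of "j - int q"] q_ge
      by (cases "j < int q") simp_all
  qed
  moreover have "k \<noteq> ?N - 2"
  proof
    assume "k = ?N - 2"
    then have "2 * j = ?N * (1 - t)" using k_eq by (simp add: algebra_simps)
    then have "?N dvd 2 * j" by (metis dvd_triv_left)
    moreover have "coprime ?N 2" using \<open>odd ?N\<close> by (simp add: coprime_commute)
    ultimately have "?N dvd j" using coprime_dvd_mult_right_iff by blast
    then show False using small[of j] assms q_ge by (auto simp: strands_def)
  qed
  moreover have "j = 1 + int q * k - (j - 1 + int q * t) * ?N"
    unfolding k_eq by (simp add: algebra_simps)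
  ultimately show thesis using that[of k "j - 1 + int q * t"] k by auto
qed

lemma glue_first_top: "0 \<le> x \<Longrightarrow> x \<le> 1 \<Longrightarrow> arm_cls r (x, 1) = arm_cls r (x, 0)"
proof (rule arm_cls_glue)
  assume "0 \<le> x" "x \<le> 1"
  then have "((x, arm_l r 1), (x, 0)) \<in> arm_glue r" unfolding arm_glue_def by fastforce
  then show "((x, 1), (x, 0)) \<in> arm_glue r" by simp
qed

lemma glue_first_side: "r \<le> y \<Longrightarrow> y \<le> 1 \<Longrightarrow> arm_cls r (1, y) = arm_cls r (0, y)"
proof (rule arm_cls_glue)
  assume "r \<le> y" "y \<le> 1"
  then have "arm_l r (1 + 1) \<le> y" "y \<le> arm_l r 1" by (simp_all add: numeral_2_eq_2[symmetric])
  then have "((arm_s r 1, y), (0, y)) \<in> arm_glue r" unfolding arm_glue_def by blast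
  then show "((1, y), (0, y)) \<in> arm_glue r" by simp
qed

lemma glue_second_side: "r\<^sup>2 \<le> y \<Longrightarrow> y \<le> r \<Longrightarrow> arm_cls r (1 + r, y) = arm_cls r (0, y)"
proof (rule arm_cls_glue)
  assume "r\<^sup>2 \<le> y" "y \<le> r"
  then have "arm_l r (2 + 1) \<le> y" "y \<le> arm_l r 2" by (simp_all add: numeral_3_eq_3[symmetric])
  moreover have "(1::nat) \<le> 2" by simp
  ultimately have "((arm_s r 2, y), (0, y)) \<in> arm_glue r" unfolding arm_glue_def by blast
  then show "((1 + r, y), (0, y)) \<in> arm_glue r" by simp
qed

text \<open>The leaf of parameter c is a single orbit, parametrised by the horizontal distance u
  from the left edge at height (c + 1) / N; \<open>ht\<close> is the height unrolled along it.  The second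
  square is traversed for \<open>2 q - 3 \<le> u \<le> period\<close>, and once more for \<open>- r \<le> u \<le> 0\<close>.\<close>

definition period :: real where
  "period = 2 * real q - 3 + r"

definition ht :: "real \<Rightarrow> real \<Rightarrow> real" where
  "ht c u = (c + 1 + real q * u) / (2 * real q - 1)"

definition pos :: "real \<Rightarrow> real \<Rightarrow> real \<times> real" where
  "pos c u = (if u < 0 then 1 + r + u else if u < 2 * real q - 3 then frac u else u - (2 * real q - 4),
              frac (ht c u))"

definition flow :: "real \<Rightarrow> real \<Rightarrow> (real \<times> real) set" where
  "flow c u = arm_cls r (pos c u)"

lemma N_pos: "0 < 2 * real q - 1"
  using Q_ge by simp

lemma period_pos: "0 < period"
  using Q_ge r_gt_0 by (simp add: period_def)

lemma N_ht: "(2 * real q - 1) * ht c u = c + 1 + real q * u"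
  using N_pos by (simp add: ht_def)

lemma N_r: "(2 * real q - 1) * r = 2 - r"
  using Q_r by (simp add: algebra_simps)

lemma N_r2: "(2 * real q - 1) * r\<^sup>2 = 2 * r - r\<^sup>2"
  using Q_r2 by (simp add: algebra_simps)

lemma le_by_N: "(2 * real q - 1) * x \<le> (2 * real q - 1) * y \<Longrightarrow> x \<le> y"
  using N_pos by simp

lemma frac_unique: "0 \<le> x - of_int n \<Longrightarrow> x - of_int n < 1 \<Longrightarrow> frac x = x - of_int n"
  by (metis Ints_of_int diff_add_cancel frac_unique_iff add_diff_cancel_left' diff_diff_eq2)

lemma flow_start:
  assumes c: "0 \<le> c" "c \<le> 1 - r" and u: "- r \<le> u" "u \<le> 0"
  shows "(u + 1 + r, ht c u) \<in> arm_P r" "flow c u = arm_cls r (u + 1 + r, ht c u)"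
    and "u < 0 \<Longrightarrow> pos c u = (u + 1 + r, ht c u)"
proof -
  have Qu: "- 1 \<le> real q * u" "real q * u \<le> 0"
    using mult_left_mono[OF u(1), of "real q"] mult_left_mono[OF u(2), of "real q"] Q_r by simp_all
  have ht: "0 \<le> ht c u" "ht c u \<le> r"
    by (rule le_by_N, unfold N_ht N_r, use Qu c in simp)+
  then show "(u + 1 + r, ht c u) \<in> arm_P r" using u by (intro second_in_P) auto
  have fr: "frac (ht c u) = ht c u" using ht r_le_half frac_unique[of "ht c u" 0] by simp
  then show *: "u < 0 \<Longrightarrow> pos c u = (u + 1 + r, ht c u)" by (simp add: pos_def)
  show "flow c u = arm_cls r (u + 1 + r, ht c u)"
  proof (cases "u < 0")
    case False
    then have "u = 0" using u by simp
    \<comment> \<open>At u = 0 \<open>pos\<close> has already switched to the left edge; the gluing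
      needs height at least r^2, which holds because N r^2 = 2r - r^2 <= 1 <= c + 1.\<close>
    have "(2 * real q - 1) * r\<^sup>2 \<le> (2 * real q - 1) * ht c u"
      unfolding N_ht N_r2 \<open>u = 0\<close> using c r_le_half r2_pos by linarith
    then have "r\<^sup>2 \<le> ht c u" by (rule le_by_N)
    moreover have "pos c u = (0, ht c u)" using fr \<open>u = 0\<close> Q_ge by (simp add: pos_def)
    ultimately show ?thesis using glue_second_side[of "ht c u"] ht \<open>u = 0\<close> by (simp add: flow_def)
  qed (simp add: * flow_def)
qed

text \<open>The constant q - 1 is the number of vertical wraps made so far: 1 + q (2q - 3) = (q - 1)
  N, so at u = 2q - 3 the unrolled height is q - 1 + c/N and the orbit enters the slit at height
  c/N.\<close>

lemma flow_end:
  assumes c: "0 \<le> c" "c \<le> 1 - r" and u: "2 * real q - 3 \<le> u" "u \<le> period"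
  shows "(u - (2 * real q - 4), ht c u - (real q - 1)) \<in> arm_P r"
    and "pos c u = (u - (2 * real q - 4), ht c u - (real q - 1))"
    and "0 \<le> ht c u - (real q - 1)"
    and "ht c u - (real q - 1) \<le> r"
    and "u < period \<Longrightarrow> ht c u - (real q - 1) < r"
    and "flow c u = arm_cls r (u - (2 * real q - 4), ht c u - (real q - 1))"
proof -
  let ?y = "ht c u - (real q - 1)"
  have Qu: "real q * (2 * real q - 3) \<le> real q * u" "real q * u \<le> real q * (2 * real q - 3) + 1"
    using mult_left_mono[OF u(1), of "real q"] mult_left_mono[OF u(2), of "real q"] Q_r
    by (simp_all add: period_def algebra_simps)
  have N_y: "(2 * real q - 1) * ?y = c + real q * u - real q * (2 * real q - 3)"
    unfolding right_diff_distrib N_ht by (simp add: algebra_simps)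
  show y: "0 \<le> ?y" "?y \<le> r"
    by (rule le_by_N, unfold N_y N_r, use Qu c in simp)+
  show "?y < r" if "u < period"
  proof -
    have "real q * u < real q * period" using that Q_ge by simp
    then have "(2 * real q - 1) * ?y < (2 * real q - 1) * r"
      unfolding N_y N_r using c Q_r by (simp add: period_def algebra_simps)
    then show ?thesis using N_pos by simp
  qed
  show "(u - (2 * real q - 4), ?y) \<in> arm_P r"
    using y u by (intro second_in_P) (auto simp: period_def)
  have "frac (ht c u) = ?y" using frac_unique[of "ht c u" "int q - 1"] y r_le_half by simp
  then show *: "pos c u = (u - (2 * real q - 4), ?y)"
    using u Q_ge by (simp add: pos_def)
  then show "flow c u = arm_cls r (u - (2 * real q - 4), ?y)" by (simp add: flow_def)
qed

text \<open>One period raises the height by q * \<open>period\<close> / N = q - 1, an integer. The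
  two times then name the same point of the second square, once as end and once as start of the
  orbit.\<close>

lemma flow_period:
  assumes c: "0 \<le> c" "c \<le> 1 - r" and u: "2 * real q - 3 \<le> u" "u \<le> period"
  shows "flow c u = flow c (u - period)"
proof -
  have "(2 * real q - 1) * ht c (u - period) = (2 * real q - 1) * (ht c u - (real q - 1))"
    unfolding right_diff_distrib N_ht using Q_r by (simp add: period_def algebra_simps)
  then have "ht c (u - period) = ht c u - (real q - 1)" using N_pos by simp
  moreover have "u - period + 1 + r = u - (2 * real q - 4)" by (simp add: period_def)
  moreover have "- r \<le> u - period" "u - period \<le> 0" using u by (auto simp: period_def)
  ultimately show ?thesis
    using flow_start(2)[OF c, of "u - period"] flow_end(6)[OF c u] by metis
qed

text \<open>The cells are closed: at u = k + 1 or at height n + 1 the class of the point on the far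
  side of the cell still agrees with \<open>flow\<close>. This permits lifts on both sides of a
  crossing and, later, pasting over closed cells.\<close>

lemma flow_mid:
  fixes k n :: int
  assumes c: "0 \<le> c" "c \<le> 1 - r" and k: "0 \<le> k" "k \<le> 2 * int q - 4"
    and u: "of_int k \<le> u" "u \<le> of_int k + 1" and n: "of_int n \<le> ht c u" "ht c u \<le> of_int n + 1"
  shows "(u - of_int k, ht c u - of_int n) \<in> arm_P r"
    and "flow c u = arm_cls r (u - of_int k, ht c u - of_int n)"
proof -
  let ?y = "ht c u - of_int n"
  show "(u - of_int k, ?y) \<in> arm_P r" using u n by (intro first_in_P) auto
  have kq: "real_of_int k + 1 \<le> 2 * real q - 3" "0 \<le> real_of_int k"
    using k by linarith+
  have vert: "arm_cls r (x, frac (ht c u)) = arm_cls r (x, ?y)" if "0 \<le> x" "x \<le> 1" for x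
  proof (cases "ht c u < of_int n + 1")
    case True
    then show ?thesis using frac_unique[of "ht c u" n] n by simp
  next
    case False
    then have "ht c u = of_int (n + 1)" using n by simp
    moreover from this have "frac (ht c u) = 0" by (simp only: frac_of_int)
    ultimately show ?thesis using glue_first_top[of x] that by simp
  qed
  \<comment> \<open>At the right end of a cell the orbit jumps to the left edge, except at u = 2q -
    3, where it stays at x = 1 to enter the second square.\<close>
  have "u < of_int k + 1 \<or> u = of_int (k + 1) \<and> k + 1 \<le> 2 * int q - 4 \<or>
      u = 2 * real q - 3 \<and> u = of_int (k + 1)"
    using u k by (cases "k = 2 * int q - 4") auto
  then consider "u < of_int k + 1" | "u = of_int (k + 1)" "k + 1 \<le> 2 * int q - 4"
    | "u = 2 * real q - 3" "u = of_int (k + 1)" by blast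
  then show "flow c u = arm_cls r (u - of_int k, ?y)"
  proof cases
    case 1
    then have "pos c u = (u - of_int k, frac (ht c u))"
      using u kq frac_unique[of u k] by (simp add: pos_def)
    then show ?thesis using vert[of "u - of_int k"] u by (simp add: flow_def)
  next
    case 2
    \<comment> \<open>The strand reached on the left edge. Excluding 0, 1 and N leaves 2 <= j <= 2q
      - 2, hence r <= y < 1, so the side gluing of the unit square applies.\<close>
    define j where "j = 1 + int q * (k + 1) - n * (2 * int q - 1)"
    have j_y: "(2 * real q - 1) * ?y = of_int j + c"
      unfolding right_diff_distrib N_ht j_def 2 by (simp add: algebra_simps)
    have "0 \<le> (2 * real q - 1) * ?y" "(2 * real q - 1) * ?y \<le> (2 * real q - 1) * 1"
      using n N_pos by (auto intro: mult_left_mono)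
    then have b: "0 \<le> of_int j + c" "of_int j + c \<le> of_int (2 * int q - 1)"
      unfolding j_y by simp_all
    have "0 \<le> j" using b(1) c r_gt_0 by linarith
    moreover have "j \<noteq> 0" "j \<noteq> 1" "j \<noteq> 2 * int q - 1"
      using crossing_index[OF _ _ j_def] crossing_index_pos[OF _ _ j_def] k 2 by auto
    ultimately have "2 \<le> j" "j \<le> 2 * int q - 2" using b(2) c by linarith+
    then have "2 - r \<le> of_int j + c" "of_int j + c < 2 * real q - 1"
      using c r_gt_0 by linarith+
    then have "(2 * real q - 1) * r \<le> (2 * real q - 1) * ?y" "(2 * real q - 1) * ?y < (2 * real q - 1) * 1"
      unfolding j_y N_r by simp_all
    then have y: "r \<le> ?y" "?y < 1" using N_pos by simp_all
    then have "frac (ht c u) = ?y" using frac_unique[of "ht c u" n] r_gt_0 by simp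
    moreover have "frac u = 0" unfolding 2 by (rule frac_of_int)
    moreover have "u < 2 * real q - 3" "0 \<le> u" using 2 kq by linarith+
    ultimately have "pos c u = (0, ?y)"
      by (simp add: pos_def)
    then show ?thesis using glue_first_side[of ?y] y 2 by (simp add: flow_def)
  next
    case 3
    then have "pos c u = (1, frac (ht c u))" using Q_ge by (simp add: pos_def)
    then show ?thesis using vert[of 1] 3(2) by (simp add: flow_def)
  qed
qed

lemma pos_mid:
  fixes k n :: int
  assumes k: "0 \<le> k" "k \<le> 2 * int q - 4" and u: "of_int k \<le> u" "u < of_int k + 1"
    and n: "of_int n \<le> ht c u" "ht c u < of_int n + 1"
  shows "pos c u = (u - of_int k, ht c u - of_int n)"
    and "lev (pos c u) = of_int (1 + int q * k - n * (2 * int q - 1)) + c"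
proof -
  have kq: "real_of_int k + 1 \<le> 2 * real q - 3" "0 \<le> real_of_int k"
    using k by linarith+
  show *: "pos c u = (u - of_int k, ht c u - of_int n)"
    using frac_unique[of u k] frac_unique[of "ht c u" n] u n kq by (simp add: pos_def)
  show "lev (pos c u) = of_int (1 + int q * k - n * (2 * int q - 1)) + c"
    unfolding * lev_def fst_conv snd_conv right_diff_distrib[of _ "ht c u"] N_ht
    by (simp add: algebra_simps)
qed

lemma lev_pos_bounds:
  assumes "0 \<le> x" "x < 1" "0 \<le> y" "y < 1"
  shows "- real q < lev (x, y)" "lev (x, y) < 2 * real q - 1"
proof -
  have *: "real q * x < real q" "(2 * real q - 1) * y < 2 * real q - 1"
    "0 \<le> real q * x" "0 \<le> (2 * real q - 1) * y"
    using assms N_pos Q_ge by auto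
  show "- real q < lev (x, y)" unfolding lev_def fst_conv snd_conv using * by linarith
  show "lev (x, y) < 2 * real q - 1" unfolding lev_def fst_conv snd_conv using * by linarith
qed

text \<open>In the unit square the range of \<open>lev\<close> bounds j and
  \<open>crossing_index\<close> excludes the omitted strands; both passages through the second
  square lie on strand -q.\<close>

lemma pos_in_leaf:
  assumes c: "0 \<le> c" "c \<le> 1 - r" and u: "- r \<le> u" "u \<le> period"
  shows "pos c u \<in> leaf c"
proof -
  have last: "- int q \<in> strands" using q_ge by (auto simp: strands_def)
  consider "u < 0" | "0 \<le> u" "u < 2 * real q - 3" | "2 * real q - 3 \<le> u" by linarith
  then show ?thesis
  proof cases
    case 1
    have "lev (u + 1 + r, ht c u) = of_int (- int q) + c"
      unfolding lev_def snd_conv fst_conv N_ht using Q_r by (simp add: algebra_simps)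
    then show ?thesis using flow_start[OF c u(1)] 1 last by (intro leafI) auto
  next
    case 2
    define k n where "k = \<lfloor>u\<rfloor>" and "n = \<lfloor>ht c u\<rfloor>"
    have k: "0 \<le> k" "k \<le> 2 * int q - 4" using 2 unfolding k_def by linarith+
    have un: "of_int k \<le> u" "u < of_int k + 1" "of_int n \<le> ht c u" "ht c u < of_int n + 1"
      unfolding k_def n_def by linarith+
    define j where "j = 1 + int q * k - n * (2 * int q - 1)"
    have lev: "lev (pos c u) = of_int j + c" and pos: "pos c u = (u - of_int k, ht c u - of_int n)"
      using pos_mid[OF k un] by (simp_all add: j_def)
    then have "- real q < of_int j + c" "of_int j + c < 2 * real q - 1"
      using lev_pos_bounds[of "u - of_int k" "ht c u - of_int n"] un by auto
    then have "- int q \<le> j" "j \<le> 2 * int q - 2" using c r_gt_0 by linarith+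
    then have "j \<in> strands" using crossing_index[OF k j_def] by (auto simp: strands_def)
    moreover have "pos c u \<in> arm_P r" unfolding pos using un by (intro first_in_P) auto
    ultimately show ?thesis using lev by (intro leafI)
  next
    case 3
    have "lev (u - (2 * real q - 4), ht c u - (real q - 1)) = of_int (- int q) + c"
      unfolding lev_def snd_conv fst_conv right_diff_distrib[of _ "ht c u"] N_ht by (simp add: algebra_simps)
    then show ?thesis using flow_end[OF c 3 u(2)] last by (intro leafI) auto
  qed
qed

lemma pos_in_P: "0 \<le> c \<Longrightarrow> c \<le> 1 - r \<Longrightarrow> - r \<le> u \<Longrightarrow> u \<le> period \<Longrightarrow> pos c u \<in> arm_P r"
  using pos_in_leaf leaf_subset_P by blast

section \<open>Regularity along the orbits, and the leaf as a single orbit\<close>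

lemma fst_pos_neq_1: "- r < u \<Longrightarrow> u < 2 * real q - 3 \<Longrightarrow> fst (pos c u) \<noteq> 1"
  using frac_lt_1[of u] by (auto simp: pos_def)

lemma pos_0_not_V:
  assumes "- r < u" "u < 2 * real q - 3"
  shows "pos 0 u \<notin> arm_V r"
proof
  assume "pos 0 u \<in> arm_V r"
  moreover have "pos 0 u \<in> leaf 0"
    using assms r_gt_0 r_le_half by (intro pos_in_leaf) (auto simp: period_def)
  ultimately have "fst (pos 0 u) = 1"
    using leaf_V[of "pos 0 u" 0] r_gt_0 r_le_half by auto
  then show False using fst_pos_neq_1 assms by simp
qed

text \<open>By \<open>leaf_V\<close> only (1 + r, r) and (0, r) are possible. The former requires
  \<open>u = period\<close>; the latter would be a return to strand 1 after k >= 1 crossings, which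
  \<open>crossing_index_pos\<close> forbids.\<close>

lemma pos_top_not_V:
  assumes "0 < u" "u < period"
  shows "pos (1 - r) u \<notin> arm_V r"
proof
  assume V: "pos (1 - r) u \<in> arm_V r"
  have c: "0 \<le> 1 - r" "1 - r \<le> 1 - r" using r_le_half by auto
  have "pos (1 - r) u \<in> leaf (1 - r)"
    using assms r_gt_0 c by (intro pos_in_leaf) (auto simp: period_def)
  then have V': "pos (1 - r) u = (0, r) \<or> pos (1 - r) u = (1 + r, r)"
    using leaf_V[OF V _ c] r_gt_0 r_le_half by auto
  have fr: "frac u \<noteq> 1 + r" using frac_lt_1[of u] r_gt_0 by linarith
  have "pos (1 - r) u = (0, r)" "u < 2 * real q - 3" "frac u = 0"
    using V' assms fr by (auto simp: pos_def period_def split: if_splits)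
  define k n where "k = \<lfloor>u\<rfloor>" and "n = \<lfloor>ht (1 - r) u\<rfloor>"
  have "u = of_int k" using \<open>frac u = 0\<close> by (simp add: frac_def k_def)
  then have k: "1 \<le> k" "k \<le> 2 * int q - 4" using assms \<open>u < 2 * real q - 3\<close> by linarith+
  have un: "of_int k \<le> u" "u < of_int k + 1" "of_int n \<le> ht (1 - r) u" "ht (1 - r) u < of_int n + 1"
    unfolding k_def n_def by linarith+
  have "lev (pos (1 - r) u) = of_int (1 + int q * k - n * (2 * int q - 1)) + (1 - r)"
    using k un by (intro pos_mid) auto
  moreover have "lev (0, r) = of_int 1 + (1 - r)" by (simp add: lev_left N_r)
  ultimately have "real_of_int (1 + int q * k - n * (2 * int q - 1)) + (1 - r) = of_int 1 + (1 - r)"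
    using \<open>pos (1 - r) u = (0, r)\<close> by metis
  then have "real_of_int (1 + int q * k - n * (2 * int q - 1)) = of_int 1"
    by (simp only: add_right_cancel)
  then have "1 + int q * k - n * (2 * int q - 1) = 1" by (simp only: of_int_eq_iff)
  then show False using crossing_index_pos(1)[OF k refl] by blast
qed

lemma pos_inner_not_V:
  assumes "0 < c" "c < 1 - r" "- r \<le> u" "u \<le> period"
  shows "pos c u \<notin> arm_V r"
  using leaf_V[of "pos c u" c] pos_in_leaf[of c u] assms by auto

text \<open>\<open>crossing_index_ex\<close> recovers from the strand the number k of crossings and
  the number n of vertical wraps; then u = k + x.\<close>

lemma leaf_flow_first:
  assumes c: "0 \<le> c" "c \<le> 1 - r" and j: "j \<in> strands" "lev (x, y) = of_int j + c"
    and xy: "0 \<le> x" "x < 1" "0 \<le> y" "y < 1"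
  shows "\<exists>u. 0 \<le> u \<and> u < period \<and> pos c u = (x, y)"
proof -
  obtain k n where k: "0 \<le> k" "k \<le> 2 * int q - 4" and jk: "j = 1 + int q * k - n * (2 * int q - 1)"
    using crossing_index_ex[OF j(1)] .
  define u where "u = of_int k + x"
  have "(2 * real q - 1) * ht c u = (2 * real q - 1) * (y + of_int n)"
    using j(2) unfolding N_ht by (simp add: lev_def jk u_def algebra_simps)
  then have y: "ht c u = y + of_int n" using N_pos by simp
  have "pos c u = (u - of_int k, ht c u - of_int n)"
    using k xy y u_def by (intro pos_mid) auto
  then have "pos c u = (x, y)" using y u_def by simp
  moreover have "real_of_int k \<le> 2 * real q - 4" "0 \<le> real_of_int k" using k by linarith+
  then have "0 \<le> u" "u < period" using xy r_gt_0 by (auto simp: u_def period_def)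
  ultimately show ?thesis by blast
qed

text \<open>Points on the top or right edge are moved to the bottom or left edge before
  \<open>leaf_flow_first\<close> applies. These moves can leave the leaf at a vertex: (1, 1) lies on
  \<open>leaf 0\<close> but (0, 1) does not.\<close>

lemma leaf_flow:
  assumes p: "p \<in> leaf c" "p \<notin> arm_V r" and c: "0 \<le> c" "c \<le> 1 - r"
  shows "\<exists>u. 0 \<le> u \<and> u < period \<and> arm_cls r p = flow c u"
proof -
  obtain x y where xy: "p = (x, y)" by fastforce
  have "(x, y) \<in> leaf c" using p xy by simp
  then show ?thesis using c
  proof (cases rule: leaf_cases)
    case (first j)
    show ?thesis
    proof (cases "y < 1")
      case True
      then show ?thesis using leaf_flow_first[OF c first(1-5)] xy by (metis flow_def)
    next
      case False
      then have y: "y = 1" using first by simp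
      have "x \<noteq> 0"
      proof
        assume "x = 0"
        then have "p = (arm_s r 0, arm_l r (0 + 1))" using y xy by simp
        then show False using p unfolding arm_V_def by blast
      qed
      then have "(x, 0) \<in> leaf c"
        using leaf_glue_first_top[of x c] first \<open>(x, y) \<in> leaf c\<close> y c r_gt_0 by auto
      then obtain i where "i \<in> strands" "lev (x, 0) = of_int i + c" by (auto simp: leaf_def)
      then obtain u where "0 \<le> u" "u < period" "pos c u = (x, 0)"
        using leaf_flow_first[OF c _ _ first(3,4)] by fastforce
      then show ?thesis using glue_first_top[of x] first y xy by (metis flow_def less_imp_le)
    qed
  next
    case (edge j)
    have "y \<noteq> 1"
    proof
      assume "y = 1"
      then have "p = (arm_s r 1, arm_l r 1)" using edge xy by simp
      then show False using p unfolding arm_V_def by blast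
    qed
    then have y: "y < 1" using edge by simp
    then have "(0, y) \<in> leaf c"
      using leaf_glue_first_side[of y c] edge \<open>(x, y) \<in> leaf c\<close> c by auto
    then obtain i where "i \<in> strands" "lev (0, y) = of_int i + c" by (auto simp: leaf_def)
    then obtain u where "0 \<le> u" "u < period" "pos c u = (0, y)"
      using leaf_flow_first[OF c, of i 0 y] y edge r_gt_0 by auto
    then show ?thesis using glue_first_side[of y] edge xy by (metis flow_def less_imp_le)
  next
    case second
    define u where "u = 2 * real q - 4 + x"
    have u: "2 * real q - 3 \<le> u" "u \<le> period" using second by (auto simp: u_def period_def)
    have "(2 * real q - 1) * ht c u = (2 * real q - 1) * (y + (real q - 1))"
      using second(5) unfolding N_ht by (simp add: lev_def u_def algebra_simps)
    then have "ht c u - (real q - 1) = y" using N_pos by simp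
    then have cls: "arm_cls r p = flow c u" using flow_end(6)[OF c u] xy by (simp add: u_def)
    show ?thesis
    proof (cases "u < period")
      case True
      then show ?thesis using cls u Q_ge by (intro exI[of _ u]) auto
    next
      case False
      then have "arm_cls r p = flow c 0" using flow_period[OF c u] u cls by simp
      then show ?thesis using period_pos by auto
    qed
  qed
qed

lemma V_special: "(1, 0) \<in> arm_V r" "(1 + r, r) \<in> arm_V r"
proof -
  have "(arm_s r 1, 0) \<in> arm_V r" "(arm_s r 2, arm_l r 2) \<in> arm_V r"
    unfolding arm_V_def by fastforce+
  then show "(1, 0) \<in> arm_V r" "(1 + r, r) \<in> arm_V r" by simp_all
qed

lemma flow_0_ends: "flow 0 (- r) = arm_sing r" "flow 0 (2 * real q - 3) = arm_sing r"
proof -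
  have c: "0 \<le> (0 :: real)" "0 \<le> 1 - r" using r_le_half by auto
  have "flow 0 (- r) = arm_cls r (1, 0)"
    using flow_start(2)[OF c, of "- r"] r_gt_0 Q_r by (simp add: ht_def)
  then show "flow 0 (- r) = arm_sing r" using V_special arm_cls_V by (simp add: arm_sing_def)
  then show "flow 0 (2 * real q - 3) = arm_sing r"
    using flow_period[OF c, of "2 * real q - 3"] r_gt_0 by (simp add: period_def)
qed

lemma flow_top_ends: "flow (1 - r) 0 = arm_sing r" "flow (1 - r) period = arm_sing r"
proof -
  have c: "0 \<le> 1 - r" "1 - r \<le> 1 - r" using r_le_half by auto
  have "ht (1 - r) 0 = r" using N_r N_pos by (simp add: ht_def field_simps)
  then have "flow (1 - r) 0 = arm_cls r (1 + r, r)"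
    using flow_start(2)[OF c, of 0] r_gt_0 by simp
  then show "flow (1 - r) 0 = arm_sing r" using V_special arm_cls_V by (simp add: arm_sing_def)
  then show "flow (1 - r) period = arm_sing r"
    using flow_period[OF c, of period] r_gt_0 by (simp add: period_def)
qed

subsection \<open>Straightness and continuity of the parametrisation\<close>

lemma ht_add: "ht c (u + d) = ht c u + d * (real q / (2 * real q - 1))"
  by (simp add: ht_def add_divide_distrib algebra_simps)

lemma ht_mono: "u \<le> v \<Longrightarrow> ht c u \<le> ht c v"
  using N_pos by (simp add: ht_def divide_right_mono mult_left_mono)

text \<open>The lift is the unrolled line (v, \<open>ht c v\<close>) translated by (-a, -b); floors
  select the cell just ahead of u.\<close>

lemma flow_right:
  assumes c: "0 \<le> c" "c \<le> 1 - r" and u: "- r \<le> u" "u < period"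
  shows "\<exists>a b e. 0 < e \<and> (\<forall>v. u \<le> v \<and> v < u + e \<longrightarrow>
    (v - a, ht c v - b) \<in> arm_P r \<and> flow c v = arm_cls r (v - a, ht c v - b))"
proof -
  consider "u < 0" | "0 \<le> u" "u < 2 * real q - 3" | "2 * real q - 3 \<le> u" by linarith
  then show ?thesis
  proof cases
    case 1
    have shift: "v - (- 1 - r) = v + 1 + r" for v by simp
    show ?thesis
      using flow_start(1,2)[OF c] u 1 unfolding shift[symmetric]
      by - (rule exI[of _ "- 1 - r"], rule exI[of _ 0], rule exI[of _ "- u"], auto)
  next
    case 2
    define k n where "k = \<lfloor>u\<rfloor>" and "n = \<lfloor>ht c u\<rfloor>"
    have k: "0 \<le> k" "k \<le> 2 * int q - 4" using 2 unfolding k_def by linarith+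
    have un: "of_int k \<le> u" "u < of_int k + 1" "of_int n \<le> ht c u" "ht c u < of_int n + 1"
      unfolding k_def n_def by linarith+
    \<comment> \<open>Distances to the right and top sides of the cell. As q/N <= 1, the height
      grows no faster than u, so one bound serves both.\<close>
    define e where "e = min (of_int k + 1 - u) (of_int n + 1 - ht c u)"
    have "0 < e" using un by (simp add: e_def)
    moreover have "(v - of_int k, ht c v - of_int n) \<in> arm_P r \<and>
        flow c v = arm_cls r (v - of_int k, ht c v - of_int n)" if v: "u \<le> v" "v < u + e" for v
    proof -
      have "ht c v \<le> ht c u + (v - u)"
        using ht_add[of c u "v - u"] Q_ge v mult_left_mono[of "real q / (2 * real q - 1)" 1 "v - u"] by simp
      then have "v \<le> of_int k + 1" "ht c v \<le> of_int n + 1" "ht c u \<le> ht c v"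
        using v ht_mono by (auto simp: e_def)
      then show ?thesis using flow_mid[OF c k, of v n] un v by simp
    qed
    ultimately show ?thesis by blast
  next
    case 3
    then show ?thesis
      using flow_end(1,6)[OF c] u
      by - (rule exI[of _ "2 * real q - 4"], rule exI[of _ "real q - 1"], rule exI[of _ "period - u"], auto)
  qed
qed

lemma flow_left:
  assumes c: "0 \<le> c" "c \<le> 1 - r" and u: "- r < u" "u \<le> period"
  shows "\<exists>a b e. 0 < e \<and> (\<forall>v. u - e < v \<and> v \<le> u \<longrightarrow>
    (v - a, ht c v - b) \<in> arm_P r \<and> flow c v = arm_cls r (v - a, ht c v - b))"
proof -
  consider "u \<le> 0" | "0 < u" "u \<le> 2 * real q - 3" | "2 * real q - 3 < u" by linarith
  then show ?thesis
  proof cases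
    case 1
    have shift: "v - (- 1 - r) = v + 1 + r" for v by simp
    show ?thesis
      using flow_start(1,2)[OF c] u 1 unfolding shift[symmetric]
      by - (rule exI[of _ "- 1 - r"], rule exI[of _ 0], rule exI[of _ "u + r"], auto)
  next
    case 2
    \<comment> \<open>Ceiling minus one, not floor: at an integer value the lift must use the cell
      occupied just before u.\<close>
    define k n where "k = \<lceil>u\<rceil> - 1" and "n = \<lceil>ht c u\<rceil> - 1"
    have k: "0 \<le> k" "k \<le> 2 * int q - 4" using 2 unfolding k_def by linarith+
    have un: "of_int k < u" "u \<le> of_int k + 1" "of_int n < ht c u" "ht c u \<le> of_int n + 1"
      unfolding k_def n_def by linarith+
    define e where "e = min (u - of_int k) (ht c u - of_int n)"
    have "0 < e" using un by (simp add: e_def)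
    moreover have "(v - of_int k, ht c v - of_int n) \<in> arm_P r \<and>
        flow c v = arm_cls r (v - of_int k, ht c v - of_int n)" if v: "u - e < v" "v \<le> u" for v
    proof -
      have "ht c u \<le> ht c v + (u - v)"
        using ht_add[of c v "u - v"] Q_ge v mult_left_mono[of "real q / (2 * real q - 1)" 1 "u - v"] by simp
      then have "of_int k \<le> v" "of_int n \<le> ht c v" "ht c v \<le> ht c u"
        using v ht_mono by (auto simp: e_def)
      then show ?thesis using flow_mid[OF c k, of v n] un v by simp
    qed
    ultimately show ?thesis by blast
  next
    case 3
    then show ?thesis
      using flow_end(1,6)[OF c] u
      by - (rule exI[of _ "2 * real q - 4"], rule exI[of _ "real q - 1"], rule exI[of _ "u - (2 * real q - 3)"], auto)
  qed
qed

text \<open>The start a is 0 for the closed trajectories and for the saddle connection at c = 1 - r,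
  and -r for the one at c = 0.\<close>

lemma flow_straight:
  assumes c: "0 \<le> c" "c \<le> 1 - r" and a: "- r \<le> a" "a \<le> 0"
  shows "arm_straight r (period, period * (real q / (2 * real q - 1))) (\<lambda>t. flow c (a + period * t))"
    (is "arm_straight r ?w _")
  unfolding arm_straight_def
proof (intro ballI conjI impI)
  let ?m = "real q / (2 * real q - 1)"
  have seg: "(a + period * t - x, ht c (a + period * t) - y) + (s - t) *\<^sub>R ?w
      = (a + period * s - x, ht c (a + period * s) - y)" for s t x y
    using ht_add[of c "a + period * t" "period * (s - t)"] by (simp add: algebra_simps)
  fix t :: real assume t: "t \<in> {0..1}"
  let ?u = "a + period * t"
  have t_bounds: "0 \<le> period * t" "period * t \<le> period"
    using t period_pos by (auto simp: mult_left_le)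
  {
    assume "t < 1"
    then have "period * t < period" using period_pos by simp
    then have "- r \<le> ?u" "?u < period" using t_bounds a by auto
    from flow_right[OF c this] obtain x y e where e: "0 < e" and P: "\<And>v. ?u \<le> v \<Longrightarrow> v < ?u + e \<Longrightarrow>
      (v - x, ht c v - y) \<in> arm_P r \<and> flow c v = arm_cls r (v - x, ht c v - y)"
      by blast
    have "(?u - x, ht c ?u - y) + (s - t) *\<^sub>R ?w \<in> arm_P r \<and>
        flow c (a + period * s) = arm_cls r ((?u - x, ht c ?u - y) + (s - t) *\<^sub>R ?w)"
      if s: "t \<le> s" "s < t + e / period" for s
    proof -
      have "period * s < period * (t + e / period)" "period * t \<le> period * s"
        using s period_pos by auto
      then have "?u \<le> a + period * s" "a + period * s < ?u + e"
        using period_pos by (auto simp: algebra_simps)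
      then show ?thesis unfolding seg using P by blast
    qed
    moreover have "0 < e / period" using e period_pos by simp
    moreover have "(?u - x, ht c ?u - y) \<in> arm_P r" "arm_cls r (?u - x, ht c ?u - y) = flow c ?u"
      using P[of ?u] e by auto
    ultimately show "\<exists>p\<in>arm_P r. arm_cls r p = flow c ?u \<and> (\<exists>e>0. \<forall>s. t \<le> s \<and> s < t + e \<and> s \<le> 1 \<longrightarrow>
        p + (s - t) *\<^sub>R ?w \<in> arm_P r \<and> flow c (a + period * s) = arm_cls r (p + (s - t) *\<^sub>R ?w))"
      by blast
  next
    assume "0 < t"
    then have "0 < period * t" using period_pos by simp
    then have "- r < ?u" "?u \<le> period" using t_bounds a by auto
    from flow_left[OF c this] obtain x y e where e: "0 < e" and P: "\<And>v. ?u - e < v \<Longrightarrow> v \<le> ?u \<Longrightarrow>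
      (v - x, ht c v - y) \<in> arm_P r \<and> flow c v = arm_cls r (v - x, ht c v - y)"
      by blast
    have "(?u - x, ht c ?u - y) - (t - s) *\<^sub>R ?w \<in> arm_P r \<and>
        flow c (a + period * s) = arm_cls r ((?u - x, ht c ?u - y) - (t - s) *\<^sub>R ?w)"
      if s: "t - e / period < s" "s \<le> t" for s
    proof -
      have "period * (t - e / period) < period * s" "period * s \<le> period * t"
        using s period_pos by auto
      then have "?u - e < a + period * s" "a + period * s \<le> ?u"
        using period_pos by (auto simp: algebra_simps)
      moreover have "p - (t - s) *\<^sub>R w = p + (s - t) *\<^sub>R w" for p w :: "real \<times> real"
        by (simp add: algebra_simps)
      ultimately show ?thesis using P seg[of t x y s] by metis
    qed
    moreover have "0 < e / period" using e period_pos by simp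
    moreover have "(?u - x, ht c ?u - y) \<in> arm_P r" "arm_cls r (?u - x, ht c ?u - y) = flow c ?u"
      using P[of ?u] e by auto
    ultimately show "\<exists>p\<in>arm_P r. arm_cls r p = flow c ?u \<and> (\<exists>e>0. \<forall>s. t - e < s \<and> s \<le> t \<and> 0 \<le> s \<longrightarrow>
        p - (t - s) *\<^sub>R ?w \<in> arm_P r \<and> flow c (a + period * s) = arm_cls r (p - (t - s) *\<^sub>R ?w))"
      by blast
  }
qed

lemma continuous_map_cls_lift:
  fixes g :: "real \<times> real \<Rightarrow> real \<times> real"
  assumes "continuous_on S g" "\<And>z. z \<in> S \<Longrightarrow> g z \<in> arm_P r"
  shows "continuous_map (top_of_set S) (arm_top r) (\<lambda>z. arm_cls r (g z))"
proof -
  have "continuous_map (top_of_set S) (top_of_set (arm_P r)) g"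
    using assms by auto
  from continuous_map_compose[OF this continuous_map_arm_cls] show ?thesis by (simp add: o_def)
qed

lemma continuous_on_ht [continuous_intros]:
  "continuous_on S f \<Longrightarrow> continuous_on S g \<Longrightarrow> continuous_on S (\<lambda>z. ht (f z) (g z))"
  unfolding ht_def using N_pos by (auto intro!: continuous_intros)

text \<open>Joint continuity in (c, u), for the homotopies. Closed cells with explicit lifts are
  pasted: \<open>Some (k, n)\<close> is a cell of the unrolled unit square, \<open>None\<close> the
  final passage through the second square. Lifts on overlapping cells agree since each represents
  \<open>flow\<close>.\<close>

lemma flow_continuous:
  "continuous_map (top_of_set ({0..1 - r} \<times> {0..period})) (arm_top r) (\<lambda>z. flow (fst z) (snd z))"
    (is "continuous_map (top_of_set ?D) _ _")
proof -
  \<comment> \<open>The height increases in both parameters, so its value at the far corner makes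
    the number of cells finite.\<close>
  define n_max where "n_max = \<lfloor>ht (1 - r) period\<rfloor>"
  define I where "I = insert None (Some ` ({0..2 * int q - 4} \<times> {0..n_max}))"
  define T where "T i = (case i of None \<Rightarrow> ?D \<inter> {z. 2 * real q - 3 \<le> snd z}
    | Some (k, n) \<Rightarrow> ?D \<inter> ({z. of_int k \<le> snd z} \<inter> {z. snd z \<le> of_int k + 1} \<inter>
        {z. of_int n \<le> ht (fst z) (snd z)} \<inter> {z. ht (fst z) (snd z) \<le> of_int n + 1}))"
    for i :: "(int \<times> int) option"
  define g where "g i z = (case i of None \<Rightarrow> (snd z - (2 * real q - 4), ht (fst z) (snd z) - (real q - 1))
    | Some (k, n) \<Rightarrow> (snd z - of_int k, ht (fst z) (snd z) - of_int n))"
    for i :: "(int \<times> int) option" and z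
  have lift: "g i z \<in> arm_P r \<and> flow (fst z) (snd z) = arm_cls r (g i z)" if "i \<in> I" "z \<in> T i" for i z
  proof (cases i)
    case None
    then show ?thesis using that flow_end(1,6)[of "fst z" "snd z"] by (auto simp: T_def g_def)
  next
    case (Some kn)
    obtain k n where "kn = (k, n)" by fastforce
    then show ?thesis using that Some flow_mid[of "fst z" k "snd z" n] by (auto simp: T_def g_def I_def)
  qed
  show ?thesis
  proof (rule pasting_lemma_closed[where I = I and T = T and f = "\<lambda>i z. arm_cls r (g i z)"])
    show "finite I" by (simp add: I_def)
    show "closedin (top_of_set ?D) (T i)" for i
    proof -
      have "closed {z :: real \<times> real. 2 * real q - 3 \<le> snd z}"
        by (intro closed_Collect_le continuous_intros)
      moreover have "closed ({z. of_int k \<le> snd z} \<inter> {z. snd z \<le> of_int k + 1} \<inter>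
        {z. of_int n \<le> ht (fst z) (snd z)} \<inter> {z. ht (fst z) (snd z) \<le> of_int n + 1})" for k n :: int
        by (intro closed_Int closed_Collect_le continuous_intros)
      ultimately show ?thesis
        unfolding T_def by (auto split: option.split intro!: closedin_closed_Int)
    qed
    show "continuous_map (subtopology (top_of_set ?D) (T i)) (arm_top r) (\<lambda>z. arm_cls r (g i z))"
      if "i \<in> I" for i
    proof -
      have "continuous_on (T i) (g i)"
        unfolding g_def by (cases i) (auto intro!: continuous_intros split: prod.split)
      moreover have "?D \<inter> T i = T i" by (auto simp: T_def split: option.splits)
      ultimately show ?thesis
        using continuous_map_cls_lift[of "T i" "g i"] lift[OF that] by (simp add: subtopology_subtopology)
    qed
    show "arm_cls r (g i z) = arm_cls r (g j z)"
      if "i \<in> I" "j \<in> I" "z \<in> topspace (top_of_set ?D) \<inter> T i \<inter> T j" for i j z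
      using lift[of i z] lift[of j z] that by auto
    show "\<exists>i. i \<in> I \<and> z \<in> T i \<and> flow (fst z) (snd z) = arm_cls r (g i z)"
      if "z \<in> topspace (top_of_set ?D)" for z
    proof -
      have z: "z \<in> ?D" using that by simp
      have "\<exists>i. i \<in> I \<and> z \<in> T i"
      proof (cases "2 * real q - 3 \<le> snd z")
        case True
        then show ?thesis using z by (intro exI[of _ None]) (simp add: I_def T_def)
      next
        case False
        define k n where "k = \<lfloor>snd z\<rfloor>" and "n = \<lfloor>ht (fst z) (snd z)\<rfloor>"
        have "0 \<le> snd z" using z by auto
        then have "0 \<le> k" "k \<le> 2 * int q - 4" using False unfolding k_def by linarith+
        moreover have "0 \<le> ht (fst z) (snd z)" "ht (fst z) (snd z) \<le> ht (1 - r) period"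
        proof -
          show "0 \<le> ht (fst z) (snd z)" using z N_pos by (auto simp: ht_def)
          have "ht (fst z) (snd z) \<le> ht (1 - r) (snd z)"
            using z N_pos by (auto simp: ht_def divide_right_mono)
          also have "\<dots> \<le> ht (1 - r) period" using z by (intro ht_mono) auto
          finally show "ht (fst z) (snd z) \<le> ht (1 - r) period" .
        qed
        then have "0 \<le> n" "n \<le> n_max" unfolding n_def n_max_def by (simp_all add: floor_mono)
        ultimately have "Some (k, n) \<in> I" by (simp add: I_def)
        moreover have "z \<in> T (Some (k, n))"
          unfolding T_def k_def n_def using z by (simp add: less_imp_le)
        ultimately show ?thesis by blast
      qed
      then show ?thesis using lift by blast
    qed
  qed
qed

lemma flow_homotopic:
  assumes c: "0 < c" "c < 1 - r" and d: "0 < d" "d < 1 - r"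
  shows "arm_homotopic_loops r (\<lambda>t. flow c (period * t)) (\<lambda>t. flow d (period * t))"
proof -
  let ?g = "\<lambda>z :: real \<times> real. ((1 - fst z) * c + fst z * d, period * snd z)"
  let ?S = "{0..1} \<times> {0..1} :: (real \<times> real) set"
  have param: "0 < (1 - s) * c + s * d \<and> (1 - s) * c + s * d < 1 - r" if "0 \<le> s" "s \<le> 1" for s
  proof
    show "0 < (1 - s) * c + s * d"
      using convex_bound_lt[of "- c" 0 "- d" "1 - s" s] c d that by simp
    show "(1 - s) * c + s * d < 1 - r"
      using convex_bound_lt[of c "1 - r" d "1 - s" s] c d that by simp
  qed
  have time: "0 \<le> period * t \<and> period * t \<le> period" if "0 \<le> t" "t \<le> 1" for t
    using that period_pos by (simp add: mult_left_le)
  have reg: "flow e (period * t) \<in> arm_Xreg r" if "0 < e" "e < 1 - r" "0 \<le> t" "t \<le> 1" for e t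
    using time[of t] that pos_in_P[of e "period * t"] pos_inner_not_V[of e "period * t"] r_gt_0
    by (auto simp: flow_def intro!: arm_cls_in_Xreg)
  have "continuous_on ?S ?g" by (intro continuous_intros)
  moreover have "?g \<in> ?S \<rightarrow> {0..1 - r} \<times> {0..period}"
    using param time by (fastforce intro: less_imp_le)
  ultimately have "continuous_map (top_of_set ?S) (top_of_set ({0..1 - r} \<times> {0..period})) ?g"
    by (simp add: Pi_iff image_subset_iff)
  from continuous_map_compose[OF this flow_continuous]
  have "continuous_map (top_of_set ?S) (arm_top r)
      (\<lambda>z. flow ((1 - fst z) * c + fst z * d) (period * snd z))"
    by (simp add: o_def)
  then have "continuous_map (top_of_set ?S) (subtopology (arm_top r) (arm_Xreg r))
      (\<lambda>z. flow ((1 - fst z) * c + fst z * d) (period * snd z))"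
    using param reg by (auto simp: continuous_map_in_subtopology)
  moreover have "flow e 0 = flow e period" if "0 < e" "e < 1 - r" for e
    using flow_period[of e period] that r_gt_0 by (simp add: period_def)
  ultimately show ?thesis
    unfolding arm_homotopic_loops_def homotopic_with_def
    using param
    by (intro exI[of _ "\<lambda>z. flow ((1 - fst z) * c + fst z * d) (period * snd z)"])
      (simp add: prod_topology_subtopology_eu)
qed

lemma flow_closed_traj:
  assumes c: "0 < c" "c < 1 - r"
  shows "arm_closed_traj r (real q / (2 * real q - 1)) (\<lambda>t. flow c (period * t))"
  unfolding arm_closed_traj_def
proof (intro conjI exI)
  show "has_slope (real q / (2 * real q - 1)) (period, period * (real q / (2 * real q - 1)))"
    using period_pos by (simp add: has_slope_def)
  show "arm_straight r (period, period * (real q / (2 * real q - 1))) (\<lambda>t. flow c (period * t))"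
    using flow_straight[of c 0] c r_gt_0 by simp
  show "flow c (period * 0) = flow c (period * 1)"
    using flow_period[of c period] c r_gt_0 by (simp add: period_def)
  show "(\<lambda>t. flow c (period * t)) ` {0..1} \<subseteq> arm_Xreg r"
  proof clarify
    fix t :: real assume "t \<in> {0..1}"
    then have "0 \<le> period * t" "period * t \<le> period"
      using period_pos by (auto simp: mult_left_le)
    then show "flow c (period * t) \<in> arm_Xreg r"
      using c pos_in_P[of c "period * t"] pos_inner_not_V[of c "period * t"] r_gt_0
      by (auto simp: flow_def intro!: arm_cls_in_Xreg)
  qed
qed

lemma flow_saddle_conn:
  assumes c: "0 \<le> c" "c \<le> 1 - r" and a: "- r \<le> a" "a \<le> 0"
    and ends: "flow c a = arm_sing r" "flow c (a + period) = arm_sing r"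
    and inner: "\<And>u. a < u \<Longrightarrow> u < a + period \<Longrightarrow> pos c u \<notin> arm_V r"
  shows "arm_saddle_conn r (\<lambda>t. flow c (a + period * t))"
  unfolding arm_saddle_conn_def
proof (intro conjI exI)
  show "(period, period * (real q / (2 * real q - 1))) \<noteq> 0"
    using period_pos by (simp add: zero_prod_def)
  show "arm_straight r (period, period * (real q / (2 * real q - 1))) (\<lambda>t. flow c (a + period * t))"
    by (rule flow_straight[OF c a])
  show "(\<lambda>t. flow c (a + period * t)) ` {0<..<1} \<subseteq> arm_Xreg r"
  proof clarify
    fix t :: real assume "t \<in> {0<..<1}"
    then have "0 < period * t" "period * t < period"
      using period_pos by auto
    then show "flow c (a + period * t) \<in> arm_Xreg r"
      using c a pos_in_P[of c "a + period * t"] inner[of "a + period * t"]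
      by (auto simp: flow_def intro!: arm_cls_in_Xreg)
  qed
qed (use ends in simp_all)

subsection \<open>The cylinder\<close>

definition cyl :: "real set \<Rightarrow> (real \<times> real) set set" where
  "cyl A = (\<Union>c\<in>A. arm_cls r ` leaf c)"

lemma cyl_iff: "A \<in> cyl S \<longleftrightarrow> (\<exists>c\<in>S. \<exists>p\<in>leaf c. A = arm_cls r p)"
  unfolding cyl_def by blast

lemma cyl_mono: "S \<subseteq> T \<Longrightarrow> cyl S \<subseteq> cyl T"
  unfolding cyl_def by blast

lemma cyl_subset_X: "cyl A \<subseteq> arm_X r"
  using leaf_subset_P arm_cls_in_X unfolding cyl_def by blast

text \<open>Saturation of the leaves: at a regular point membership of the class can be tested on
  any representative.\<close>

lemma cls_in_cyl_iff:
  assumes A: "A \<subseteq> {0..1 - r}" and p: "p \<in> arm_P r" "p \<notin> arm_V r"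
  shows "arm_cls r p \<in> cyl A \<longleftrightarrow> (\<exists>c\<in>A. p \<in> leaf c)"
proof
  assume "arm_cls r p \<in> cyl A"
  then obtain c p' where c: "c \<in> A" "p' \<in> leaf c" "arm_cls r p = arm_cls r p'" by (auto simp only: cyl_iff)
  moreover have "p' \<in> arm_P r" using c leaf_subset_P by auto
  ultimately have "(p, p') \<in> arm_rel r" using arm_cls_eq_iff p by blast
  then have rel: "(p', p) \<in> arm_rel r" using equiv_arm_rel by (meson equiv_def symE)
  have "p' \<notin> arm_V r"
    using arm_cls_V[of p'] arm_cls_self[OF p(1)] p(2) c by auto
  then have "p \<in> leaf c" using leaf_rel[OF rel _ c(2)] A c(1) by auto
  then show "\<exists>c\<in>A. p \<in> leaf c" using c by blast
qed (auto simp only: cyl_iff)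

lemma inner_leaf_not_V: "0 < c \<Longrightarrow> c < 1 - r \<Longrightarrow> p \<in> leaf c \<Longrightarrow> p \<notin> arm_V r"
  using leaf_V[of p c] by auto

lemma inner_cls_neq_sing: "0 < c \<Longrightarrow> c < 1 - r \<Longrightarrow> p \<in> leaf c \<Longrightarrow> arm_cls r p \<noteq> arm_V r"
  using inner_leaf_not_V[of c p] arm_cls_self[of p] leaf_subset_P by blast

lemma leaf_unique:
  assumes "p \<in> leaf c" "p \<in> leaf d" "0 \<le> c" "c \<le> 1 - r" "0 \<le> d" "d \<le> 1 - r"
  shows "c = d"
proof -
  obtain j where "lev p = of_int j + c" using assms(1) by (auto simp: leaf_def)
  moreover obtain k where "lev p = of_int k + d" using assms(2) by (auto simp: leaf_def)
  ultimately show ?thesis using int_plus_frac_cancel(2)[of j c k d] assms r_gt_0 by auto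
qed

lemma flow_image:
  assumes c: "0 < c" "c < 1 - r"
  shows "(\<lambda>t. flow c (period * t)) ` {0..1} = arm_cls r ` leaf c"
proof (intro equalityI subsetI)
  fix A assume "A \<in> (\<lambda>t. flow c (period * t)) ` {0..1}"
  then obtain t where t: "0 \<le> t" "t \<le> 1" "A = flow c (period * t)" by auto
  then have "0 \<le> period * t" "period * t \<le> period" using period_pos by (auto simp: mult_left_le)
  then show "A \<in> arm_cls r ` leaf c"
    using t pos_in_leaf[of c "period * t"] c r_gt_0 by (auto simp: flow_def)
next
  fix A assume "A \<in> arm_cls r ` leaf c"
  then obtain p where p: "p \<in> leaf c" "A = arm_cls r p" by auto
  then obtain u where u: "0 \<le> u" "u < period" "A = flow c u"
    using leaf_flow[OF p(1) inner_leaf_not_V[OF c p(1)]] c by auto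
  then have "A = flow c (period * (u / period))" "u / period \<in> {0..1}"
    using period_pos by auto
  then show "A \<in> (\<lambda>t. flow c (period * t)) ` {0..1}" by blast
qed

lemma Union_cyl_inner: "\<Union>(cyl {0<..<1 - r}) = arm_P r \<inter> lev -` (\<Union>j\<in>strands. {of_int j<..<of_int j + 1 - r})"
proof -
  have 1: "p \<in> \<Union>(cyl {0<..<1 - r}) \<longleftrightarrow> (\<exists>c\<in>{0<..<1 - r}. p \<in> leaf c)" if p: "p \<in> arm_P r" for p
  proof (cases "p \<in> arm_V r")
    case True
    have "arm_V r \<notin> cyl {0<..<1 - r}"
      unfolding cyl_def using inner_cls_neq_sing by force
    then have "p \<notin> \<Union>(cyl {0<..<1 - r})"
      using mem_Union_iff[OF cyl_subset_X] arm_cls_V[OF True] by metis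
    moreover have "\<not> (\<exists>c\<in>{0<..<1 - r}. p \<in> leaf c)"
      using inner_leaf_not_V[of _ p] True by auto
    ultimately show ?thesis by blast
  next
    case False
    have "p \<in> \<Union>(cyl {0<..<1 - r}) \<longleftrightarrow> arm_cls r p \<in> cyl {0<..<1 - r}"
      using mem_Union_iff[OF cyl_subset_X] p by metis
    also have "\<dots> \<longleftrightarrow> (\<exists>c\<in>{0<..<1 - r}. p \<in> leaf c)"
      using p False by (intro cls_in_cyl_iff) auto
    finally show ?thesis .
  qed
  have 2: "(\<exists>c\<in>{0<..<1 - r}. p \<in> leaf c) \<longleftrightarrow>
      p \<in> arm_P r \<inter> lev -` (\<Union>j\<in>strands. {of_int j<..<of_int j + 1 - r})" for p
  proof
    assume "p \<in> arm_P r \<inter> lev -` (\<Union>j\<in>strands. {of_int j<..<of_int j + 1 - r})"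
    then obtain j where "p \<in> arm_P r" "j \<in> strands" "of_int j < lev p" "lev p < of_int j + 1 - r" by auto
    then show "\<exists>c\<in>{0<..<1 - r}. p \<in> leaf c"
      by (intro bexI[of _ "lev p - of_int j"]) (auto intro: leafI)
  next
    assume "\<exists>c\<in>{0<..<1 - r}. p \<in> leaf c"
    then obtain c j where "c \<in> {0<..<1 - r}" "p \<in> arm_P r" "j \<in> strands" "lev p = of_int j + c"
      by (auto simp: leaf_def)
    then show "p \<in> arm_P r \<inter> lev -` (\<Union>j\<in>strands. {of_int j<..<of_int j + 1 - r})"
      by (intro IntI vimageI2 UN_I[of j]) auto
  qed
  show ?thesis
  proof (intro set_eqI)
    fix p
    show "p \<in> \<Union>(cyl {0<..<1 - r}) \<longleftrightarrow>
      p \<in> arm_P r \<inter> lev -` (\<Union>j\<in>strands. {of_int j<..<of_int j + 1 - r})"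
    proof (cases "p \<in> arm_P r")
      case True
      then show ?thesis by (rule trans[OF 1 2])
    next
      case False
      then have "p \<notin> \<Union>(cyl {0<..<1 - r})" using mem_Union_iff[OF cyl_subset_X] by metis
      then show ?thesis using False by blast
    qed
  qed
qed

lemma sing_in_cyl: "arm_V r \<in> cyl {0..1 - r}"
proof -
  have "(1, 0) \<in> leaf 0"
    using q_ge by (intro leafI[of _ "- int q"] first_in_P) (auto simp: strands_def lev_def)
  moreover have "0 \<in> {0..1 - r}" using r_le_half by simp
  ultimately have "arm_cls r (1, 0) \<in> cyl {0..1 - r}" unfolding cyl_iff by blast
  then show ?thesis using arm_cls_V V_special by simp
qed

text \<open>The singular class lies in the closed cylinder through (1, 0) and brings in all vertices
  of P, including those on no leaf; hence the extra term and the use of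
  \<open>closedin_arm_V\<close> below.\<close>

lemma Union_cyl_closed:
  "\<Union>(cyl {0..1 - r}) = arm_V r \<union> arm_P r \<inter> lev -` (\<Union>j\<in>strands. {of_int j..of_int j + 1 - r})"
proof -
  have 1: "(\<exists>c\<in>{0..1 - r}. p \<in> leaf c) \<longleftrightarrow>
      p \<in> arm_P r \<inter> lev -` (\<Union>j\<in>strands. {of_int j..of_int j + 1 - r})" for p
  proof
    assume "p \<in> arm_P r \<inter> lev -` (\<Union>j\<in>strands. {of_int j..of_int j + 1 - r})"
    then obtain j where "p \<in> arm_P r" "j \<in> strands" "of_int j \<le> lev p" "lev p \<le> of_int j + 1 - r" by auto
    then show "\<exists>c\<in>{0..1 - r}. p \<in> leaf c"
      by (intro bexI[of _ "lev p - of_int j"]) (auto intro: leafI)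
  next
    assume "\<exists>c\<in>{0..1 - r}. p \<in> leaf c"
    then obtain c j where "c \<in> {0..1 - r}" "p \<in> arm_P r" "j \<in> strands" "lev p = of_int j + c"
      by (auto simp: leaf_def)
    then show "p \<in> arm_P r \<inter> lev -` (\<Union>j\<in>strands. {of_int j..of_int j + 1 - r})"
      by (intro IntI vimageI2 UN_I[of j]) auto
  qed
  have 2: "p \<in> \<Union>(cyl {0..1 - r}) \<longleftrightarrow> p \<in> arm_V r \<or> (\<exists>c\<in>{0..1 - r}. p \<in> leaf c)" if p: "p \<in> arm_P r" for p
  proof (cases "p \<in> arm_V r")
    case True
    then show ?thesis using sing_in_cyl by blast
  next
    case False
    have "p \<in> \<Union>(cyl {0..1 - r}) \<longleftrightarrow> arm_cls r p \<in> cyl {0..1 - r}"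
      using mem_Union_iff[OF cyl_subset_X] p by metis
    also have "\<dots> \<longleftrightarrow> (\<exists>c\<in>{0..1 - r}. p \<in> leaf c)"
      using p False by (intro cls_in_cyl_iff) auto
    finally show ?thesis using False by blast
  qed
  show ?thesis
  proof (intro set_eqI)
    fix p
    show "p \<in> \<Union>(cyl {0..1 - r}) \<longleftrightarrow>
      p \<in> arm_V r \<union> arm_P r \<inter> lev -` (\<Union>j\<in>strands. {of_int j..of_int j + 1 - r})"
    proof (cases "p \<in> arm_P r")
      case True
      have "p \<in> \<Union>(cyl {0..1 - r}) \<longleftrightarrow> p \<in> arm_V r \<or> (\<exists>c\<in>{0..1 - r}. p \<in> leaf c)"
        by (rule 2[OF True])
      then show ?thesis unfolding 1 by blast
    next
      case False
      then have "p \<notin> \<Union>(cyl {0..1 - r})" using mem_Union_iff[OF cyl_subset_X] by metis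
      then show ?thesis using False arm_V_subset_P by blast
    qed
  qed
qed

section \<open>Closedness, interior and frontier of the cylinder\<close>

lemma continuous_on_lev: "continuous_on S lev"
  unfolding lev_def[abs_def] by (intro continuous_intros)

lemma openin_cyl_inner: "openin (arm_top r) (cyl {0<..<1 - r})"
  unfolding openin_arm_top Union_cyl_inner
  by (intro conjI cyl_subset_X openin_open_Int open_vimage continuous_on_lev open_UN) auto

lemma closedin_cyl: "closedin (arm_top r) (cyl {0..1 - r})"
proof (rule closedin_arm_top[OF cyl_subset_X])
  have "finite strands" by (simp add: strands_def)
  then have "closed (lev -` (\<Union>j\<in>strands. {of_int j..of_int j + 1 - r}))"
    by (intro closed_vimage continuous_on_lev closed_UN) auto
  then show "closedin (top_of_set (arm_P r)) (\<Union>(cyl {0..1 - r}))"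
    unfolding Union_cyl_closed by (intro closedin_Un closedin_arm_V closedin_closed_Int)
qed

text \<open>The strips of levels have length 1 - r and start at integers, so a gap of length r lies
  below every integer, whether or not that integer is in \<open>strands\<close>.\<close>

lemma strand_gap:
  assumes "of_int j - r < x" "x < of_int j"
  shows "x \<notin> (\<Union>i\<in>strands. {of_int i..of_int i + 1 - r})"
proof
  assume "x \<in> (\<Union>i\<in>strands. {of_int i..of_int i + 1 - r})"
  then obtain i where i: "of_int i \<le> x" "x \<le> of_int i + 1 - r" by auto
  have "real_of_int i < of_int j" using i assms by linarith
  then have "i \<le> j - 1" by linarith
  then have "real_of_int i \<le> of_int j - 1" by linarith
  then show False using i assms by linarith
qed

lemma strand_gap':
  assumes "of_int j + 1 - r < x" "x < of_int j + 1"
  shows "x \<notin> (\<Union>i\<in>strands. {of_int i..of_int i + 1 - r})"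
proof
  assume "x \<in> (\<Union>i\<in>strands. {of_int i..of_int i + 1 - r})"
  then obtain i where i: "of_int i \<le> x" "x \<le> of_int i + 1 - r" by auto
  have "real_of_int i < of_int j + 1" using i assms by linarith
  then have "i \<le> j" by linarith
  then have "real_of_int i \<le> of_int j" by linarith
  then show False using i assms by linarith
qed

text \<open>A single ray from a single representative refutes openness: the union of an open set of
  classes is relatively open in P, so it contains the ray for small e.\<close>

lemma not_interior_if_gap:
  assumes W: "openin (arm_top r) W" "W \<subseteq> cyl {0..1 - r}"
    and p: "p \<in> \<Union>W" and \<delta>: "0 < \<delta>"
    and gap: "\<And>e. 0 < e \<Longrightarrow> e < \<delta> \<Longrightarrow> p + e *\<^sub>R w \<in> arm_P r \<and> p + e *\<^sub>R w \<notin> arm_V r \<and>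
        lev (p + e *\<^sub>R w) \<notin> (\<Union>j\<in>strands. {of_int j..of_int j + 1 - r})"
  shows False
proof -
  obtain U where U: "open U" "\<Union>W = arm_P r \<inter> U"
    using W(1) by (auto simp: openin_arm_top openin_open)
  have "((\<lambda>e. p + e *\<^sub>R w) \<longlongrightarrow> p + 0 *\<^sub>R w) (at_right 0)"
    by (intro tendsto_intros)
  then have "eventually (\<lambda>e. p + e *\<^sub>R w \<in> U) (at_right 0)"
    using U p by (intro topological_tendstoD) auto
  moreover have "eventually (\<lambda>e. e < \<delta> \<and> 0 < e) (at_right 0)"
    using \<delta> by (intro eventually_conj eventually_at_right_less) (auto simp: eventually_at_right)
  ultimately have "eventually (\<lambda>e. p + e *\<^sub>R w \<in> U \<and> e < \<delta> \<and> 0 < e) (at_right 0)"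
    by (rule eventually_conj)
  then obtain e where "p + e *\<^sub>R w \<in> U" "e < \<delta>" "0 < e"
    using eventually_happens by fastforce
  then have "p + e *\<^sub>R w \<in> \<Union>W" "p + e *\<^sub>R w \<notin> \<Union>(cyl {0..1 - r})"
    using gap[of e] U(2) unfolding Union_cyl_closed by auto
  then show False using W(2) by blast
qed

lemma not_V_between:
  assumes "0 < x \<and> x < 1 \<or> 1 < x \<and> x < 1 + r"
  shows "(x, y) \<notin> arm_V r"
proof
  assume "(x, y) \<in> arm_V r"
  then obtain i where i: "x = arm_s r i" using arm_V_D(1) by blast
  consider "i = 0" | "i = 1" | "2 \<le> i" by linarith
  then show False using i assms arm_s_ge[of i] r_gt_0 by cases auto
qed

text \<open>The half-open ranges guarantee room to the right of and above the representative, for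
  the displacements used to leave the cylinder.\<close>

lemma pos_range:
  assumes c: "0 \<le> c" "c \<le> 1 - r" and u: "0 \<le> u" "u < period"
  obtains x y where "pos c u = (x, y)"
    "0 \<le> x \<and> x < 1 \<and> 0 \<le> y \<and> y < 1 \<or> 1 \<le> x \<and> x < 1 + r \<and> 0 \<le> y \<and> y < r"
proof (cases "u < 2 * real q - 3")
  case True
  then have "pos c u = (frac u, frac (ht c u))" using u by (simp add: pos_def)
  then show thesis using that frac_lt_1 by (metis frac_ge_0)
next
  case False
  then show thesis using that flow_end(2,3,5)[OF c] u by (auto simp: period_def)
qed

lemma cyl_interior: "arm_top r interior_of cyl {0..1 - r} = cyl {0<..<1 - r}"
proof (rule interior_of_unique)
  show "cyl {0<..<1 - r} \<subseteq> cyl {0..1 - r}" by (rule cyl_mono) auto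
  show "openin (arm_top r) (cyl {0<..<1 - r})" by (rule openin_cyl_inner)
  fix W assume W: "W \<subseteq> cyl {0..1 - r}" "openin (arm_top r) W"
  note gap = not_interior_if_gap[OF W(2) W(1)]
  have sing: "arm_V r \<notin> W"
  proof
    assume "arm_V r \<in> W"
    \<comment> \<open>Any vertex may represent the singularity. Leftwards from (1 + r, 0), along the
      bottom of the second square, the levels lie strictly between -q - 1 and -q, below every
      strand.\<close>
    have "(arm_s r 2, 0) \<in> arm_V r" unfolding arm_V_def by blast
    then have "(1 + r, 0) \<in> \<Union>W" using \<open>arm_V r \<in> W\<close> by auto
    then show False
    proof (rule gap[OF _ r_gt_0, where w = "(- 1, 0)"])
      fix e assume e: "0 < e" "e < r"
      have "real q * e < 1" using e Q_ge mult_strict_left_mono[of e r "real q"] Q_r by simp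
      then have "lev (1 + r - e, 0) < - real q" "- real q - 1 < lev (1 + r - e, 0)"
        using Q_r Q_ge e by (simp_all add: lev_def algebra_simps)
      then have "lev (1 + r - e, 0) \<notin> (\<Union>j\<in>strands. {of_int j..of_int j + 1 - r})"
        using lev_low_not_leaf[of "(1 + r - e, 0)"] by (auto simp: strands_def)
      then show "(1 + r, 0) + e *\<^sub>R (- 1, 0) \<in> arm_P r \<and> (1 + r, 0) + e *\<^sub>R (- 1, 0) \<notin> arm_V r \<and>
          lev ((1 + r, 0) + e *\<^sub>R (- 1, 0)) \<notin> (\<Union>j\<in>strands. {of_int j..of_int j + 1 - r})"
        using e second_in_P[of "1 + r - e" 0] r_gt_0 not_V_between[of "1 + r - e" 0] by simp
    qed
  qed
  show "W \<subseteq> cyl {0<..<1 - r}"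
  proof
    fix A assume A: "A \<in> W"
    then have "A \<in> cyl {0..1 - r}" using W(1) by blast
    then obtain c p where c: "0 \<le> c" "c \<le> 1 - r" and p: "p \<in> leaf c" "A = arm_cls r p"
      by (auto simp only: cyl_iff atLeastAtMost_iff)
    have "p \<notin> arm_V r" using sing A p arm_cls_V[of p] by metis
    then obtain u where u: "0 \<le> u" "u < period" "A = flow c u"
      using leaf_flow[OF p(1) _ c] p(2) by auto
    obtain x y where xy: "pos c u = (x, y)"
      "0 \<le> x \<and> x < 1 \<and> 0 \<le> y \<and> y < 1 \<or> 1 \<le> x \<and> x < 1 + r \<and> 0 \<le> y \<and> y < r"
      using pos_range[OF c u(1,2)] .
    have leaf: "(x, y) \<in> leaf c" using pos_in_leaf[OF c, of u] u r_gt_0 xy by simp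
    then obtain j where j: "j \<in> strands" "lev (x, y) = of_int j + c" by (auto simp: leaf_def)
    have mem: "(x, y) \<in> \<Union>W"
      using A u xy arm_cls_self[of "(x, y)"] leaf leaf_subset_P by (auto simp: flow_def)
    define \<delta> where "\<delta> = (if x < 1 then min (1 - x) (1 - y) else min (1 + r - x) (r - y))"
    have \<delta>: "0 < \<delta>" using xy by (auto simp: \<delta>_def)
    have near: "(x + e, y + b * e) \<in> arm_P r \<and> (x + e, y + b * e) \<notin> arm_V r"
      if "0 < e" "e < \<delta>" "0 \<le> b" "b \<le> 1" for e b
    proof -
      define d where "d = b * e"
      have "0 \<le> d" "d \<le> e" using that by (auto simp: d_def mult_left_le_one_le)
      then show ?thesis
        using that(1,2) xy(2) not_V_between[of "x + e" "y + d"] first_in_P[of "x + e" "y + d"]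
          second_in_P[of "x + e" "y + d"]
        unfolding d_def[symmetric] by (auto simp: \<delta>_def split: if_splits)
    qed
    have "c \<noteq> 0"
    proof
      assume "c = 0"
      \<comment> \<open>Moving right lowers the level at rate q; since q r^2 = r, displacements
        below r * r stay inside the gap of length r under j.\<close>
      have "0 < min \<delta> (r * r)" using \<delta> r_gt_0 by simp
      with mem show False
      proof (rule gap[where w = "(1, 0)"])
        fix e assume e: "0 < e" "e < min \<delta> (r * r)"
        then have "real q * e < real q * (r * r)" using Q_ge by simp
        then have "real q * e < r" using Q_r by (simp add: mult.assoc[symmetric])
        moreover have "lev (x + e, y) = of_int j - real q * e"
          using j \<open>c = 0\<close> by (simp add: lev_def algebra_simps)
        moreover have "0 < real q * e" using e Q_ge by simp
        ultimately show "(x, y) + e *\<^sub>R (1, 0) \<in> arm_P r \<and> (x, y) + e *\<^sub>R (1, 0) \<notin> arm_V r \<and>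
          lev ((x, y) + e *\<^sub>R (1, 0)) \<notin> (\<Union>j\<in>strands. {of_int j..of_int j + 1 - r})"
          using near[of e 0] e strand_gap[of j "lev (x + e, y)"] by simp
      qed
    qed
    moreover have "c \<noteq> 1 - r"
    proof
      assume "c = 1 - r"
      \<comment> \<open>Direction (1, 1) raises the level at rate N - q = q - 1 > 0, into the gap
        above the strip; its horizontal part takes the point off the vertical lines that carry
        vertices.\<close>
      have "0 < min \<delta> (r * r)" using \<delta> r_gt_0 by simp
      with mem show False
      proof (rule gap[where w = "(1, 1)"])
        fix e assume e: "0 < e" "e < min \<delta> (r * r)"
        then have "real q * e < real q * (r * r)" using Q_ge by simp
        then have "real q * e < r" using Q_r by (simp add: mult.assoc[symmetric])
        moreover have "lev (x + e, y + e) = of_int j + 1 - r + (real q * e - e)"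
          using j \<open>c = 1 - r\<close> by (simp add: lev_def algebra_simps)
        moreover have "2 * e \<le> real q * e" using e Q_ge by simp
        ultimately show "(x, y) + e *\<^sub>R (1, 1) \<in> arm_P r \<and> (x, y) + e *\<^sub>R (1, 1) \<notin> arm_V r \<and>
          lev ((x, y) + e *\<^sub>R (1, 1)) \<notin> (\<Union>j\<in>strands. {of_int j..of_int j + 1 - r})"
          using near[of e 1] e strand_gap'[of j "lev (x + e, y + e)"] by simp
      qed
    qed
    ultimately have "c \<in> {0<..<1 - r}" using c by simp
    then show "A \<in> cyl {0<..<1 - r}" using p unfolding cyl_iff by blast
  qed
qed

lemma cyl_boundary: "arm_top r frontier_of cyl {0..1 - r} = cyl {0, 1 - r}"
proof -
  have c0: "0 \<le> (0 :: real)" "0 \<le> 1 - r" "1 - r \<le> 1 - r" using r_le_half by auto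
  have "arm_top r frontier_of cyl {0..1 - r} = cyl {0..1 - r} - cyl {0<..<1 - r}"
    using closedin_cyl closure_of_closedin by (auto simp: frontier_of_def cyl_interior)
  also have "\<dots> = cyl {0, 1 - r}"
  proof (intro equalityI subsetI)
    fix A assume "A \<in> cyl {0..1 - r} - cyl {0<..<1 - r}"
    then obtain c p where c: "c \<in> {0..1 - r}" "p \<in> leaf c" "A = arm_cls r p" and "A \<notin> cyl {0<..<1 - r}"
      by (auto simp only: cyl_iff Diff_iff)
    then have "c \<notin> {0<..<1 - r}" unfolding cyl_iff by blast
    then have "c \<in> {0, 1 - r}" using c(1) by auto
    then show "A \<in> cyl {0, 1 - r}" using c unfolding cyl_iff by blast
  next
    fix A assume A: "A \<in> cyl {0, 1 - r}"
    \<comment> \<open>A common class would have a regular representative from the inner leaf;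
      saturation puts it on a boundary leaf as well, against uniqueness of the parameter.\<close>
    have "A \<notin> cyl {0<..<1 - r}"
    proof
      assume "A \<in> cyl {0<..<1 - r}"
      then obtain d p where d: "0 < d" "d < 1 - r" "p \<in> leaf d" "A = arm_cls r p"
        by (auto simp only: cyl_iff greaterThanLessThan_iff)
      have p: "p \<in> arm_P r" "p \<notin> arm_V r" using d leaf_subset_P inner_leaf_not_V by auto
      obtain c where "c \<in> {0, 1 - r}" "p \<in> leaf c"
        using A d(4) cls_in_cyl_iff[OF _ p, of "{0, 1 - r}"] c0 by (auto simp del: insert_iff)
      then show False using leaf_unique[of p c d] d c0 by auto
    qed
    moreover have "cyl {0, 1 - r} \<subseteq> cyl {0..1 - r}" using c0 by (intro cyl_mono) auto
    ultimately show "A \<in> cyl {0..1 - r} - cyl {0<..<1 - r}" using A by blast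
  qed
  finally show ?thesis .
qed

text \<open>Times in [0, \<open>period\<close>) already cover the regular points of the leaf. For a
  < 0 those after \<open>a + period\<close> are moved back by one period, which
  \<open>flow_period\<close> permits along the second square only; \<open>wrap\<close> therefore
  restricts a negative start to -r.\<close>

lemma boundary_flow_image:
  assumes c: "0 \<le> c" "c \<le> 1 - r" and a: "- r \<le> a" "a \<le> 0" and sing: "flow c a = arm_sing r"
    and wrap: "a < 0 \<Longrightarrow> a = - r"
  shows "(\<lambda>t. flow c (a + period * t)) ` {0..1} = insert (arm_V r) (arm_cls r ` leaf c)"
proof (intro equalityI subsetI)
  fix A assume "A \<in> (\<lambda>t. flow c (a + period * t)) ` {0..1}"
  then obtain t where t: "0 \<le> t" "t \<le> 1" "A = flow c (a + period * t)" by auto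
  then have "0 \<le> period * t" "period * t \<le> period" using period_pos by (auto simp: mult_left_le)
  then show "A \<in> insert (arm_V r) (arm_cls r ` leaf c)"
    using t pos_in_leaf[OF c, of "a + period * t"] a by (auto simp: flow_def)
next
  fix A assume A: "A \<in> insert (arm_V r) (arm_cls r ` leaf c)"
  have "\<exists>v. 0 \<le> v \<and> v \<le> period \<and> A = flow c (a + v)"
  proof (cases "A = arm_V r")
    case True
    then show ?thesis using sing period_pos by (intro exI[of _ 0]) (simp add: arm_sing_def)
  next
    case False
    then obtain p where p: "p \<in> leaf c" "A = arm_cls r p" using A by auto
    then have "p \<notin> arm_V r" using False arm_cls_V by metis
    then obtain u where u: "0 \<le> u" "u < period" "A = flow c u"
      using leaf_flow[OF p(1) _ c] p(2) by auto
    show ?thesis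
    proof (cases "u \<le> a + period")
      case True
      then show ?thesis using u a by (intro exI[of _ "u - a"]) simp
    next
      case False
      then have "2 * real q - 3 \<le> u" using wrap u a by (cases "a < 0") (auto simp: period_def)
      then have "A = flow c (u - period)" using flow_period[OF c, of u] u by simp
      moreover have "r \<le> period" using Q_ge by (simp add: period_def)
      ultimately show ?thesis using False u a by (intro exI[of _ "u - period - a"]) simp
    qed
  qed
  then obtain v where v: "0 \<le> v" "v \<le> period" "A = flow c (a + v)" by blast
  then have "A = flow c (a + period * (v / period))" "v / period \<in> {0..1}"
    using period_pos by auto
  then show "A \<in> (\<lambda>t. flow c (a + period * t)) ` {0..1}" by blast
qed

lemma cyl_is_cylinder: "arm_cylinder r (real q / (2 * real q - 1)) (cyl {0..1 - r})"
  unfolding arm_cylinder_def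
proof (intro conjI)
  let ?\<gamma> = "\<lambda>c t. flow c (period * t)"
  let ?F = "?\<gamma> ` {0<..<1 - r}"
  have c0: "0 \<le> (0 :: real)" "0 \<le> 1 - r" "1 - r \<le> 1 - r" "- r \<le> 0" "- r \<le> - r" "- r < 0"
    using r_le_half r_gt_0 by auto
  show "cyl {0..1 - r} \<subseteq> arm_X r" by (rule cyl_subset_X)
  show "closedin (arm_top r) (cyl {0..1 - r})" by (rule closedin_cyl)
  show "\<exists>F. F \<noteq> {} \<and> (\<forall>\<gamma>\<in>F. arm_closed_traj r (real q / (2 * real q - 1)) \<gamma>) \<and>
      (\<Union>\<gamma>\<in>F. \<gamma> ` {0..1}) = arm_top r interior_of cyl {0..1 - r} \<and>
      (\<forall>\<gamma>\<in>F. \<forall>\<delta>\<in>F. \<gamma> ` {0..1} = \<delta> ` {0..1} \<or> \<gamma> ` {0..1} \<inter> \<delta> ` {0..1} = {}) \<and>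
      (\<forall>\<gamma>\<in>F. \<forall>\<delta>\<in>F. arm_homotopic_loops r \<gamma> \<delta>)"
  proof (intro exI[of _ ?F] conjI)
    show "?F \<noteq> {}" using r_less_1 by simp
    show "\<forall>\<gamma>\<in>?F. arm_closed_traj r (real q / (2 * real q - 1)) \<gamma>"
      using flow_closed_traj by auto
    show "(\<Union>\<gamma>\<in>?F. \<gamma> ` {0..1}) = arm_top r interior_of cyl {0..1 - r}"
      unfolding cyl_interior unfolding cyl_def using flow_image by simp
    show "\<forall>\<gamma>\<in>?F. \<forall>\<delta>\<in>?F. arm_homotopic_loops r \<gamma> \<delta>"
      using flow_homotopic by auto
    have "c = d" if c: "c \<in> {0<..<1 - r}" and d: "d \<in> {0<..<1 - r}"
      and meet: "?\<gamma> c ` {0..1} \<inter> ?\<gamma> d ` {0..1} \<noteq> {}" for c d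
    proof -
      obtain p p' where p: "p \<in> leaf c" "p' \<in> leaf d" "arm_cls r p = arm_cls r p'"
        using meet flow_image[of c] flow_image[of d] c d by auto
      then have "p \<in> arm_P r" "p \<notin> arm_V r" "arm_cls r p \<in> cyl {d}"
        using leaf_subset_P inner_leaf_not_V[of c p] c unfolding cyl_iff by auto
      then have "p \<in> leaf d" using cls_in_cyl_iff[of "{d}" p] d by auto
      then show ?thesis using leaf_unique[of p c d] p c d by simp
    qed
    then show "\<forall>\<gamma>\<in>?F. \<forall>\<delta>\<in>?F. \<gamma> ` {0..1} = \<delta> ` {0..1} \<or> \<gamma> ` {0..1} \<inter> \<delta> ` {0..1} = {}"
      by blast
  qed
  \<comment> \<open>Each boundary leaf is cut open where it meets the singularity: c = 0 at time -r,
    the point (1, 0); c = 1 - r at time 0, the point (1 + r, r) glued to (0, r).\<close>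
  let ?\<sigma> = "\<lambda>t. flow 0 (- r + period * t)" and ?\<tau> = "\<lambda>t. flow (1 - r) (0 + period * t)"
  have "arm_saddle_conn r ?\<sigma>"
    using flow_0_ends pos_0_not_V c0 by (intro flow_saddle_conn) (auto simp: period_def)
  moreover have "arm_saddle_conn r ?\<tau>"
    using flow_top_ends pos_top_not_V c0 by (intro flow_saddle_conn) auto
  moreover have "?\<sigma> ` {0..1} \<union> ?\<tau> ` {0..1} = cyl {0, 1 - r}"
  proof -
    have "arm_V r \<in> arm_cls r ` leaf 0"
    proof -
      have "pos 0 (- r) \<in> leaf 0" using c0 period_pos by (intro pos_in_leaf) auto
      then show ?thesis using flow_0_ends(1) by (auto simp: flow_def arm_sing_def)
    qed
    moreover have "?\<sigma> ` {0..1} = insert (arm_V r) (arm_cls r ` leaf 0)"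
      using flow_0_ends c0 by (intro boundary_flow_image) auto
    moreover have "?\<tau> ` {0..1} = insert (arm_V r) (arm_cls r ` leaf (1 - r))"
      using flow_top_ends c0 by (intro boundary_flow_image) auto
    ultimately show ?thesis unfolding cyl_def by auto
  qed
  ultimately show "\<exists>S. (\<forall>\<gamma>\<in>S. arm_saddle_conn r \<gamma>) \<and> (\<Union>\<gamma>\<in>S. \<gamma> ` {0..1}) = arm_top r frontier_of cyl {0..1 - r}"
    unfolding cyl_boundary by (intro exI[of _ "{?\<sigma>, ?\<tau>}"]) simp
qed

lemma cyl_subset_squares: "cyl {0..1 - r} \<subseteq> arm_cls r ` (arm_square r 1 \<union> arm_square r 2)"
  using leaf_subset_squares unfolding cyl_def by (intro UN_least image_mono) auto

end

theorem theorem2p3: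
  fixes q :: nat
  assumes "2 \<le> q"
  defines "r \<equiv> 1 / real q"
  shows "\<exists>C. arm_cylinder r (real q / (2 * real q - 1)) C \<and>
             C \<subseteq> arm_cls r ` (arm_square r 1 \<union> arm_square r 2)"
proof -
  interpret armadillo_inv q r
    using assms by unfold_locales auto
  show ?thesis using cyl_is_cylinder cyl_subset_squares by blast
qed

end
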